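(* Let $Q=343$, $\alpha_1=0.32$, $\alpha_2=0.62$, $A=202$, $B=1.9$, $C=3.04$, $T_c=-10$, $R=12.6$, $M=25$. Then for all sufficiently small $\epsilon>0$, the ice free Earth ($\eta=1$) and the big ice cap ($\eta=\eta_1\cong0.2$) are unstable, while the small ice cap ($\eta=\eta_2\cong0.962$) and the snowball Earth ($\eta=0$) are stable.
   Context: Function space: $I=[0,1]$; $\mathcal{B}_I$ is the space of continuous real functions on $I$ with the sup norm; $\mathcal{B}_I\times I$ carries the norm $\max\{\|\cdot\|_{\mathcal{B}_I},|\cdot|\}$. Let $$s(y)=1-0.482\,\frac{3y^2-1}{2},\qquad \alpha(\eta)(y)=\frac{\alpha_1+\alpha_2}{2}+\frac{\alpha_2-\alpha_1}{2}\tanh[M(y-\eta)].$$ The coupled system for the temperature profile $T\in\mathcal{B}_I$ and ice line $\eta\in I$ is the discrete-time system with yearly increments $$\Delta T(y)=\frac1R\Big[Qs(y)(1-\alpha(\eta)(y))-(A+BT(y))-C\Big(T(y)-\int_0^1T(z)\,dz\Big)\Big],\qquad \Delta\eta=\epsilon\,(T(\eta)-T_c).$$ The ice line is not admissible outside $[0,1]$: at $\eta=0$ one uses $\Delta\eta=\max\{0,\epsilon(T(\eta)-T_c)\}$, at $\eta=1$ one uses $\Delta\eta=\min\{0,\epsilon(T(\eta)-T_c)\}$, and an ice line that would leave $[0,1]$ is stopped at the endpoint. For fixed $\eta$, the unique profile with $\Delta T=0$ is $$T^*(\eta)(y)=\frac{Qs(y)(1-\alpha(\eta)(y))-A+\frac{C}{B}(Q\overline\alpha(\eta)-A)}{B+C},\qquad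 \overline\alpha(\eta)=\int_0^1 s(y)(1-\alpha(\eta)(y))\,dy.$$ With the given parameters the equation $T^*(\eta)(\eta)=T_c$ has two solutions in $[0,1]$, $\eta_1\cong0.2$ (the big ice cap) and $\eta_2\cong0.962$ (the small ice cap). The snowball Earth is the state with $\eta=0$ and the ice free Earth is the state with $\eta=1$. The four states are the points $[T^*(\eta),\eta]$ with $\eta\in\{0,\eta_1,\eta_2,1\}$. Such a state is called stable if it is (locally) asymptotically stable for the coupled system on $\mathcal{B}_I\times I$: trajectories started sufficiently close to it stay close to it and converge to it. It is called unstable if it is not stable; in particular a boundary state from which the ice line moves away into the interior is unstable.
   Formalization: With these parameters the small ice cap root is about 0.947, so the value 0.962 is not correct to three digits; proved instead: exactly two roots, with |η₁ − 0.2| < 0.05 and |η₂ − 0.962| < 0.02. *)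

theory Defs
  imports "HOL-Analysis.Analysis"
begin

record ice_line_params =
  pQ :: real
  p\<alpha>\<^sub>1 :: real
  p\<alpha>\<^sub>2 :: real
  pA :: real
  pB :: real
  pC :: real
  pT\<^sub>c :: real
  pR :: real
  pM :: real

definition insolation :: "real \<Rightarrow> real" where
  "insolation y = 1 - 0.482 * ((3 * y\<^sup>2 - 1) / 2)"

definition albedo :: "ice_line_params \<Rightarrow> real \<Rightarrow> real \<Rightarrow> real" where
  "albedo p \<eta> y =
     (p\<alpha>\<^sub>1 p + p\<alpha>\<^sub>2 p) / 2 + (p\<alpha>\<^sub>2 p - p\<alpha>\<^sub>1 p) / 2 * tanh (pM p * (y - \<eta>))"

definition mean_absorbed :: "ice_line_params \<Rightarrow> real \<Rightarrow> real" where
  "mean_absorbed p \<eta> = integral {0..1} (\<lambda>y. insolation y * (1 - albedo p \<eta> y))"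

text \<open>
  An element of the space of continuous real functions on \<open>[0,1]\<close> is represented by a function
  \<open>real \<Rightarrow> real\<close> that is continuous on \<open>{0..1}\<close>.  Its values outside \<open>{0..1}\<close> are irrelevant:
  the norm and the dynamics below only evaluate profiles on \<open>{0..1}\<close>, so two representatives of
  the same element are at distance \<open>0\<close>.
\<close>

definition sup_norm :: "(real \<Rightarrow> real) \<Rightarrow> real" where
  "sup_norm T = (SUP y\<in>{0..1}. \<bar>T y\<bar>)"

type_synonym state = "(real \<Rightarrow> real) \<times> real"

definition states :: "state set" where
  "states = {T. continuous_on {0..1} T} \<times> {0..1}"

definition state_dist :: "state \<Rightarrow> state \<Rightarrow> real" where
  "state_dist x x' = max (sup_norm (\<lambda>y. fst x y - fst x' y)) \<bar>snd x - snd x'\<bar>"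

definition temp_increment :: "ice_line_params \<Rightarrow> state \<Rightarrow> real \<Rightarrow> real" where
  "temp_increment p = (\<lambda>(T, \<eta>) y.
     1 / pR p * (pQ p * insolation y * (1 - albedo p \<eta> y) - (pA p + pB p * T y)
       - pC p * (T y - integral {0..1} T)))"

definition ice_increment :: "ice_line_params \<Rightarrow> real \<Rightarrow> state \<Rightarrow> real" where
  "ice_increment p \<epsilon> = (\<lambda>(T, \<eta>).
     if \<eta> = 0 then max 0 (\<epsilon> * (T \<eta> - pT\<^sub>c p))
     else if \<eta> = 1 then min 0 (\<epsilon> * (T \<eta> - pT\<^sub>c p))
     else \<epsilon> * (T \<eta> - pT\<^sub>c p))"

text \<open>
  One year of the coupled system.  Both increments are evaluated at the old state; the outer
  \<open>max\<close> and \<open>min\<close> stop an ice line that would leave \<open>[0,1]\<close> at the endpoint.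
\<close>

definition year :: "ice_line_params \<Rightarrow> real \<Rightarrow> state \<Rightarrow> state" where
  "year p \<epsilon> x =
     ((\<lambda>y. fst x y + temp_increment p x y), max 0 (min 1 (snd x + ice_increment p \<epsilon> x)))"

definition T_star :: "ice_line_params \<Rightarrow> real \<Rightarrow> real \<Rightarrow> real" where
  "T_star p \<eta> y =
     (pQ p * insolation y * (1 - albedo p \<eta> y) - pA p
       + pC p / pB p * (pQ p * mean_absorbed p \<eta> - pA p)) / (pB p + pC p)"

definition stable_state :: "ice_line_params \<Rightarrow> real \<Rightarrow> state \<Rightarrow> bool" where
  "stable_state p \<epsilon> z \<longleftrightarrow>
     (\<forall>r>0. \<exists>\<delta>>0. \<forall>x\<in>states. state_dist x z < \<delta> \<longrightarrow>
        (\<forall>n. state_dist ((year p \<epsilon> ^^ n) x) z < r)) \<and>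
     (\<exists>\<delta>>0. \<forall>x\<in>states. state_dist x z < \<delta> \<longrightarrow>
        (\<lambda>n. state_dist ((year p \<epsilon> ^^ n) x) z) \<longlonglongrightarrow> 0)"

abbreviation unstable_state :: "ice_line_params \<Rightarrow> real \<Rightarrow> state \<Rightarrow> bool" where
  "unstable_state p \<epsilon> z \<equiv> \<not> stable_state p \<epsilon> z"

end

theory Submission
  imports Defs
begin

text \<open>
  For a frozen ice line \<open>\<eta>\<close> one year contracts the distance of \<open>T\<close> to \<open>T_star p \<eta>\<close> in the sup norm
  by the factor \<open>1 - B / R\<close>, while \<open>T_star p \<eta>\<close> depends on \<open>\<eta>\<close> in a Lipschitz way.  So with
  \<open>u = \<parallel>T - T_star p \<eta>\<parallel>\<close> and \<open>e = \<bar>\<eta> - \<eta>\<^sub>0\<bar>\<close> the system is slow-fast: \<open>e + w u\<close> is a Lyapunov function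
  for a suitable small \<open>w\<close> if the diagonal \<open>h \<eta> = T_star p \<eta> \<eta>\<close> is decreasing at \<open>\<eta>\<^sub>0\<close> (or if
  \<open>\<eta>\<^sub>0 = 0\<close> and \<open>h 0 < T\<^sub>c\<close>), whereas the cone \<open>u \<le> c (\<eta> - \<eta>\<^sub>0)\<close> is invariant and its points are driven
  away geometrically if \<open>h\<close> is increasing at \<open>\<eta>\<^sub>0\<close>.  If \<open>h 1 < T\<^sub>c\<close>, the ice free state is not even a
  fixed point.

  The zeros of \<open>h - T\<^sub>c\<close> are located by integrating \<open>\<integral> s(y) tanh (M (y - \<eta>)) dy\<close> by parts, which
  turns \<open>tanh\<close> into \<open>ln cosh\<close>, and replacing \<open>ln (cosh u)\<close> by \<open>\<bar>u\<bar> - ln 2\<close> up to \<open>exp (- 2 \<bar>u\<bar>)\<close>.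
\<close>

section \<open>The mean absorbed radiation\<close>

lemma ln_cosh_eq:
  fixes u :: real
  shows "ln (cosh u) = \<bar>u\<bar> - ln 2 + ln (1 + exp (- (2 * \<bar>u\<bar>)))"
proof -
  have "cosh u = cosh \<bar>u\<bar>"
    by simp
  also have "\<dots> = exp \<bar>u\<bar> * (1 + exp (- (2 * \<bar>u\<bar>))) / 2"
    by (simp add: cosh_def distrib_left flip: exp_add)
  finally have c: "cosh u = exp \<bar>u\<bar> * (1 + exp (- (2 * \<bar>u\<bar>))) / 2" .
  have "(1::real) + exp (- (2 * \<bar>u\<bar>)) > 0"
    by (simp add: add_pos_pos)
  then show ?thesis
    unfolding c by (subst ln_div, simp, simp, subst ln_mult_pos) auto
qed

lemma ln_cosh_lower: "\<bar>u\<bar> - ln 2 \<le> ln (cosh u)" for u :: real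
  unfolding ln_cosh_eq by simp

lemma ln_cosh_upper: "ln (cosh u) \<le> \<bar>u\<bar> - ln 2 + exp (- (2 * \<bar>u\<bar>))" for u :: real
  unfolding ln_cosh_eq using ln_add_one_self_le_self[of "exp (- (2 * \<bar>u\<bar>))"] by simp

lemma tanh_lipschitz: "\<bar>tanh a - tanh b\<bar> \<le> \<bar>a - b\<bar>" for a b :: real
proof -
  have "norm (tanh a - tanh b) \<le> 1 * norm (a - b)"
  proof (rule field_differentiable_bound[of UNIV tanh "\<lambda>x. 1 - tanh x ^ 2"])
    fix x :: real
    have "tanh x ^ 2 \<le> 1"
      using tanh_real_bounds[of x] by (simp add: abs_square_le_1 abs_le_iff)
    then show "norm (1 - (tanh x)\<^sup>2) \<le> 1"
      by simp
  qed (auto intro!: derivative_eq_intros)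
  then show ?thesis
    by simp
qed

section \<open>The tanh moment of the insolation and its derivative\<close>

definition tanh_moment :: "real \<Rightarrow> real \<Rightarrow> real" where
  "tanh_moment M \<eta> = integral {0..1} (\<lambda>y. insolation y * tanh (M * (y - \<eta>)))"

text \<open>Minus the derivative of \<open>tanh_moment\<close>, already integrated by parts: the
  peaked kernel M (1 - tanh^2) is gone and only tanh, bounded by 1, remains to be estimated. The
  factor 1446 / 1000 comes from s'(y) = - 1.446 y.\<close>

definition tanh_moment_slope :: "real \<Rightarrow> real \<Rightarrow> real" where
  "tanh_moment_slope M \<eta> =
     insolation 1 * tanh (M * (1 - \<eta>)) + insolation 0 * tanh (M * \<eta>)
       + 1446 / 1000 * integral {0..1} (\<lambda>y. y * tanh (M * (y - \<eta>)))"

lemma insolation_eq: "insolation y = 1241 / 1000 - 723 / 1000 * y\<^sup>2"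
  by (simp add: insolation_def field_simps)

lemma insolation_0: "insolation 0 = 1241 / 1000" and insolation_1: "insolation 1 = 518 / 1000"
  by (simp_all add: insolation_eq)

lemma continuous_on_insolation [continuous_intros]: "continuous_on S insolation"
  unfolding insolation_eq by (intro continuous_intros)

lemma has_integral_insolation: "(insolation has_integral 1) {0..1}"
proof -
  have "((\<lambda>y. 1241 / 1000 - 723 / 1000 * y\<^sup>2) has_integral
      (1241 / 1000 * 1 - 241 / 1000 * 1 ^ 3) - (1241 / 1000 * 0 - 241 / 1000 * 0 ^ 3)) {0..1::real}"
    by (rule fundamental_theorem_of_calculus)
      (auto intro!: derivative_eq_intros simp: has_real_derivative_iff_has_vector_derivative[symmetric])
  moreover have "insolation = (\<lambda>y. 1241 / 1000 - 723 / 1000 * y\<^sup>2)"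
    using insolation_eq by blast
  ultimately show ?thesis
    by simp
qed

text \<open>As s has integral 1, the ice line enters the mean only through one scalar
  function.\<close>

lemma mean_absorbed_eq:
  "mean_absorbed p \<eta> = 1 - (p\<alpha>\<^sub>1 p + p\<alpha>\<^sub>2 p) / 2 - (p\<alpha>\<^sub>2 p - p\<alpha>\<^sub>1 p) / 2 * tanh_moment (pM p) \<eta>"
proof -
  have "((\<lambda>y. insolation y * tanh (pM p * (y - \<eta>))) has_integral tanh_moment (pM p) \<eta>) {0..1}"
    unfolding tanh_moment_def
    by (intro integrable_integral integrable_continuous_real continuous_intros) auto
  from has_integral_diff[OF has_integral_mult_right[OF has_integral_insolation,
        of "1 - (p\<alpha>\<^sub>1 p + p\<alpha>\<^sub>2 p) / 2"] has_integral_mult_right[OF this, of "(p\<alpha>\<^sub>2 p - p\<alpha>\<^sub>1 p) / 2"]]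
  show ?thesis
    unfolding mean_absorbed_def albedo_def
    by (intro integral_unique) (simp add: algebra_simps)
qed

text \<open>This is the fundamental theorem for s(y) tanh (M (y - \<eta>)), whose derivative is the
  integrand here minus 1.446 y tanh (M (y - \<eta>)).\<close>

lemma tanh_moment_slope_eq:
  "integral {0..1} (\<lambda>y. insolation y * (M * (1 - (tanh (M * (y - \<eta>)))\<^sup>2))) = tanh_moment_slope M \<eta>"
proof -
  let ?t = "\<lambda>y. tanh (M * (y - \<eta>))"
  have "((\<lambda>y. insolation y * (M * (1 - (?t y)\<^sup>2)) - 1446 / 1000 * (y * ?t y)) has_integral
      insolation 1 * ?t 1 - insolation 0 * ?t 0) {0..1}"
    unfolding insolation_eq
    by (rule fundamental_theorem_of_calculus)
      (auto intro!: derivative_eq_intros simp: field_simps has_real_derivative_iff_has_vector_derivative[symmetric])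
  moreover have "((\<lambda>y. y * ?t y) has_integral integral {0..1} (\<lambda>y. y * ?t y)) {0..1}"
    by (intro integrable_integral integrable_continuous_real continuous_intros) auto
  ultimately have "((\<lambda>y. (insolation y * (M * (1 - (?t y)\<^sup>2)) - 1446 / 1000 * (y * ?t y)) + 1446 / 1000 * (y * ?t y))
      has_integral (insolation 1 * ?t 1 - insolation 0 * ?t 0) + 1446 / 1000 * integral {0..1} (\<lambda>y. y * ?t y)) {0..1}"
    by (intro has_integral_add has_integral_mult_right)
  then show ?thesis
    unfolding tanh_moment_slope_def by (intro integral_unique) (simp add: algebra_simps)
qed

lemma tanh_moment_deriv: "(tanh_moment M has_real_derivative - tanh_moment_slope M \<eta>) (at \<eta>)"
proof -
  have "((\<lambda>\<eta>. integral (cbox 0 1) (\<lambda>y. insolation y * tanh (M * (y - \<eta>)))) has_field_derivative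
      integral (cbox 0 1) (\<lambda>y. - (insolation y * (M * (1 - (tanh (M * (y - \<eta>)))\<^sup>2))))) (at \<eta> within UNIV)"
  proof (rule leibniz_rule_field_derivative)
    show "((\<lambda>\<eta>. insolation y * tanh (M * (y - \<eta>))) has_field_derivative
        - (insolation y * (M * (1 - (tanh (M * (y - x)))\<^sup>2)))) (at x within UNIV)" for x y
      by (auto intro!: derivative_eq_intros)
    show "(\<lambda>y. insolation y * tanh (M * (y - x))) integrable_on cbox 0 1" for x
      unfolding cbox_interval
      by (intro integrable_continuous_real continuous_intros) auto
    show "continuous_on (UNIV \<times> cbox 0 1)
        (\<lambda>(x, y). - (insolation y * (M * (1 - (tanh (M * (y - x)))\<^sup>2))))"
      unfolding split_beta insolation_def by (intro continuous_intros) auto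
  qed auto
  then show ?thesis
    using tanh_moment_slope_eq[of M \<eta>] by (simp add: tanh_moment_def[abs_def])
qed

section \<open>Two-sided bounds on the tanh moment\<close>

text \<open>\<open>?L\<close> is an antiderivative of tanh (M (y - \<eta>)), so the derivative of s
  \<open>?L\<close> is s tanh - 1.446 y \<open>?L\<close>. The equation is solved for the integral
  of y \<open>?L\<close>, so that pointwise bounds on ln cosh carry over to
  \<open>tanh_moment\<close>.\<close>

lemma tanh_moment_by_parts:
  assumes "M \<noteq> 0"
  shows "((\<lambda>y. y * (ln (cosh (M * (y - \<eta>))) / M)) has_integral
    (tanh_moment M \<eta> - (insolation 1 * (ln (cosh (M * (1 - \<eta>))) / M) - insolation 0 * (ln (cosh (M * \<eta>)) / M)))
      / (1446 / 1000)) {0..1}"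
proof -
  let ?L = "\<lambda>y. ln (cosh (M * (y - \<eta>))) / M"
  have L0: "?L 0 = ln (cosh (M * \<eta>)) / M"
    by simp
  have dL: "(?L has_real_derivative tanh (M * (y - \<eta>))) (at y within S)" for y S
    using assms by (auto intro!: derivative_eq_intros simp: tanh_def)
  have parts: "((\<lambda>y. insolation y * tanh (M * (y - \<eta>)) - 1446 / 1000 * (y * ?L y)) has_integral
      insolation 1 * ?L 1 - insolation 0 * ?L 0) {0..1}"
  proof (rule fundamental_theorem_of_calculus)
    have ds: "(insolation has_real_derivative - 1446 / 1000 * y) (at y within S)" for y S
      unfolding insolation_eq[abs_def] by (auto intro!: derivative_eq_intros)
    show "((\<lambda>y. insolation y * ?L y) has_vector_derivative
        insolation y * tanh (M * (y - \<eta>)) - 1446 / 1000 * (y * ?L y)) (at y within {0..1})" for y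
      using DERIV_mult[OF ds[of y] dL[of y], of "{0..1}"]
      by (simp add: has_real_derivative_iff_has_vector_derivative[symmetric] algebra_simps)
  qed simp
  have moment: "((\<lambda>y. insolation y * tanh (M * (y - \<eta>))) has_integral tanh_moment M \<eta>) {0..1}"
    unfolding tanh_moment_def
    by (intro integrable_integral integrable_continuous_real continuous_intros) auto
  show ?thesis
    using has_integral_divide[OF has_integral_diff[OF moment parts], of "1446 / 1000"] unfolding L0 by simp
qed

text \<open>One closed form serves both bounds: c = 0 for the lower estimate of ln cosh and c = 1 /
  M for the upper one, with k = ln 2 / M in both.\<close>

lemma has_integral_weighted_abs_exp:
  fixes \<eta> :: real
  assumes "M \<noteq> 0" "\<eta> \<in> {0..1}"
  shows "((\<lambda>y. y * (\<bar>y - \<eta>\<bar> - k) + c * exp (- (2 * M * \<bar>y - \<eta>\<bar>))) has_integral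
    (1 / 3 - \<eta> / 2 + \<eta> ^ 3 / 3 - k / 2 + c * (2 - exp (- (2 * M * \<eta>)) - exp (- (2 * M * (1 - \<eta>)))) / (2 * M))) {0..1}"
proof -
  let ?f = "\<lambda>y. y * (\<bar>y - \<eta>\<bar> - k) + c * exp (- (2 * M * \<bar>y - \<eta>\<bar>))"
  \<comment> \<open>\<open>?F\<close> and \<open>?G\<close> are antiderivatives to the left and to
    the right of the kink at \<eta>.\<close>
  let ?F = "\<lambda>y. \<eta> * y\<^sup>2 / 2 - y ^ 3 / 3 - k * y\<^sup>2 / 2 + c * exp (- (2 * M * (\<eta> - y))) / (2 * M)"
  let ?G = "\<lambda>y. y ^ 3 / 3 - \<eta> * y\<^sup>2 / 2 - k * y\<^sup>2 / 2 - c * exp (- (2 * M * (y - \<eta>))) / (2 * M)"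
  have "((\<lambda>y. y * (\<eta> - y - k) + c * exp (- (2 * M * (\<eta> - y)))) has_integral ?F \<eta> - ?F 0) {0..\<eta>}"
    by (rule fundamental_theorem_of_calculus)
      (use assms in \<open>auto intro!: derivative_eq_intros
        simp: algebra_simps power2_eq_square has_real_derivative_iff_has_vector_derivative[symmetric]\<close>)
  then have left: "(?f has_integral ?F \<eta> - ?F 0) {0..\<eta>}"
    by (rule has_integral_eq[rotated]) auto
  have "((\<lambda>y. y * (y - \<eta> - k) + c * exp (- (2 * M * (y - \<eta>)))) has_integral ?G 1 - ?G \<eta>) {\<eta>..1}"
    by (rule fundamental_theorem_of_calculus)
      (use assms in \<open>auto intro!: derivative_eq_intros
        simp: algebra_simps power2_eq_square has_real_derivative_iff_has_vector_derivative[symmetric]\<close>)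
  then have right: "(?f has_integral ?G 1 - ?G \<eta>) {\<eta>..1}"
    by (rule has_integral_eq[rotated]) auto
  have "(?f has_integral (?F \<eta> - ?F 0) + (?G 1 - ?G \<eta>)) {0..1}"
    by (rule has_integral_combine[OF _ _ left right]) (use assms in auto)
  moreover have "(?F \<eta> - ?F 0) + (?G 1 - ?G \<eta>) = 1 / 3 - \<eta> / 2 + \<eta> ^ 3 / 3 - k / 2
      + c * (2 - exp (- (2 * M * \<eta>)) - exp (- (2 * M * (1 - \<eta>)))) / (2 * M)"
  proof -
    have "c * (2 - a - b) / (2 * M) = c / (2 * M) - c * a / (2 * M) + c / (2 * M) - c * b / (2 * M)" for a b
      by (simp add: right_diff_distrib diff_divide_distrib)
    then show ?thesis
      by (simp add: power3_eq_cube power2_eq_square)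
  qed
  ultimately show ?thesis
    by (simp only:)
qed

lemma ln_cosh_scaled_lower:
  fixes x :: real
  assumes "M > 0"
  shows "\<bar>x\<bar> - ln 2 / M \<le> ln (cosh (M * x)) / M"
  using divide_right_mono[OF ln_cosh_lower[of "M * x"], of M] assms
  by (simp add: abs_mult diff_divide_distrib)

lemma ln_cosh_scaled_upper:
  fixes x :: real
  assumes "M > 0"
  shows "ln (cosh (M * x)) / M \<le> \<bar>x\<bar> - ln 2 / M + exp (- (2 * M * \<bar>x\<bar>)) / M"
  using divide_right_mono[OF ln_cosh_upper[of "M * x"], of M] assms
  by (simp add: abs_mult diff_divide_distrib add_divide_distrib mult_ac)

text \<open>The polynomial 1.241 \<eta> - 0.241 \<eta>^3 is the integral of s over [0, \<eta>], so
  the main term is the moment with tanh replaced by the sign function. The error stems from ln cosh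
  at y = 0, which enters with a minus sign and so needs its upper bound.\<close>

lemma tanh_moment_lower:
  assumes M: "M > 0" and \<eta>: "\<eta> \<in> {0..1}"
  shows "1 - 2 * (1241 / 1000 * \<eta> - 241 / 1000 * \<eta> ^ 3) - 1241 / 1000 / M \<le> tanh_moment M \<eta>"
proof -
  define k where "k = ln 2 / M"
  have lower: "\<bar>x\<bar> - k \<le> ln (cosh (M * x)) / M" for x
    using ln_cosh_scaled_lower[OF M, of x] by (simp add: k_def)
  have "ln (cosh (M * \<eta>)) / M \<le> \<bar>\<eta>\<bar> - k + exp (- (2 * M * \<bar>\<eta>\<bar>)) / M"
    using ln_cosh_scaled_upper[OF M, of \<eta>] by (simp add: k_def)
  also have "\<dots> \<le> \<eta> - k + 1 / M"
    using M \<eta> by (auto intro!: divide_right_mono mult_nonneg_nonneg)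
  finally have L0: "ln (cosh (M * \<eta>)) / M \<le> \<eta> - k + 1 / M" .
  have L1: "1 - \<eta> - k \<le> ln (cosh (M * (1 - \<eta>))) / M"
    using lower[of "1 - \<eta>"] \<eta> by auto
  have "1 / 3 - \<eta> / 2 + \<eta> ^ 3 / 3 - k / 2 \<le> (tanh_moment M \<eta>
      - (insolation 1 * (ln (cosh (M * (1 - \<eta>))) / M) - insolation 0 * (ln (cosh (M * \<eta>)) / M))) / (1446 / 1000)"
  proof (rule has_integral_le)
    show "((\<lambda>y. y * (\<bar>y - \<eta>\<bar> - k)) has_integral 1 / 3 - \<eta> / 2 + \<eta> ^ 3 / 3 - k / 2) {0..1}"
      using has_integral_weighted_abs_exp[of M \<eta> k 0] M \<eta> by simp
    show "y * (\<bar>y - \<eta>\<bar> - k) \<le> y * (ln (cosh (M * (y - \<eta>))) / M)" if "y \<in> {0..1}" for y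
      using lower[of "y - \<eta>"] that by (intro mult_left_mono) auto
  qed (use tanh_moment_by_parts M in auto)
  then have "(1 / 3 - \<eta> / 2 + \<eta> ^ 3 / 3 - k / 2) * (1446 / 1000) \<le> tanh_moment M \<eta>
      - (insolation 1 * (ln (cosh (M * (1 - \<eta>))) / M) - insolation 0 * (ln (cosh (M * \<eta>)) / M))"
    by (rule pos_le_divide_eq[THEN iffD1, rotated]) simp
  then have low: "518 / 1000 * (ln (cosh (M * (1 - \<eta>))) / M) - 1241 / 1000 * (ln (cosh (M * \<eta>)) / M)
      + 1446 / 1000 * (1 / 3 - \<eta> / 2 + \<eta> ^ 3 / 3 - k / 2) \<le> tanh_moment M \<eta>"
    unfolding insolation_0 insolation_1 by linarith
  \<comment> \<open>The terms in k cancel because - 518 + 1241 - 1446 / 2 = 0.\<close>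
  have "1 - 2 * (1241 / 1000 * \<eta> - 241 / 1000 * \<eta> ^ 3) - 1241 / 1000 / M = 518 / 1000 * (1 - \<eta> - k) - 1241 / 1000 * (\<eta> - k + 1 / M)
      + 1446 / 1000 * (1 / 3 - \<eta> / 2 + \<eta> ^ 3 / 3 - k / 2)"
    using M by (simp add: field_simps)
  also have "\<dots> \<le> 518 / 1000 * (ln (cosh (M * (1 - \<eta>))) / M) - 1241 / 1000 * (ln (cosh (M * \<eta>)) / M)
      + 1446 / 1000 * (1 / 3 - \<eta> / 2 + \<eta> ^ 3 / 3 - k / 2)"
    using L0 L1 by (intro add_right_mono diff_mono mult_left_mono) auto
  also note low
  finally show ?thesis .
qed

text \<open>Here the upper bound on ln cosh is needed at y = 1 and in the integral. The exponential
  at y = 1 is kept: with 1 in its place the later estimate at \<eta> = 0.942 would be too weak. The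
  exponentials in the integral cost at most 1 / M^2.\<close>

lemma tanh_moment_upper:
  assumes M: "M > 0" and \<eta>: "\<eta> \<in> {0..1}"
  shows "tanh_moment M \<eta> \<le> 1 - 2 * (1241 / 1000 * \<eta> - 241 / 1000 * \<eta> ^ 3)
    + 518 / 1000 * exp (- (2 * M * (1 - \<eta>))) / M + 1446 / 1000 / M\<^sup>2"
proof -
  define k where "k = ln 2 / M"
  have upper: "ln (cosh (M * x)) / M \<le> \<bar>x\<bar> - k + exp (- (2 * M * \<bar>x\<bar>)) / M" for x
    using ln_cosh_scaled_upper[OF M, of x] by (simp add: k_def)
  have L0: "\<eta> - k \<le> ln (cosh (M * \<eta>)) / M"
    using ln_cosh_scaled_lower[OF M, of \<eta>] \<eta> by (simp add: k_def)
  have L1: "ln (cosh (M * (1 - \<eta>))) / M \<le> 1 - \<eta> - k + exp (- (2 * M * (1 - \<eta>))) / M"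
    using upper[of "1 - \<eta>"] \<eta> by auto
  have "(tanh_moment M \<eta>
      - (insolation 1 * (ln (cosh (M * (1 - \<eta>))) / M) - insolation 0 * (ln (cosh (M * \<eta>)) / M))) / (1446 / 1000)
    \<le> 1 / 3 - \<eta> / 2 + \<eta> ^ 3 / 3 - k / 2
      + 1 / M * (2 - exp (- (2 * M * \<eta>)) - exp (- (2 * M * (1 - \<eta>)))) / (2 * M)"
  proof (rule has_integral_le)
    show "((\<lambda>y. y * (\<bar>y - \<eta>\<bar> - k) + 1 / M * exp (- (2 * M * \<bar>y - \<eta>\<bar>))) has_integral
        1 / 3 - \<eta> / 2 + \<eta> ^ 3 / 3 - k / 2
        + 1 / M * (2 - exp (- (2 * M * \<eta>)) - exp (- (2 * M * (1 - \<eta>)))) / (2 * M)) {0..1}"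
      by (rule has_integral_weighted_abs_exp) (use M \<eta> in auto)
    show "y * (ln (cosh (M * (y - \<eta>))) / M)
        \<le> y * (\<bar>y - \<eta>\<bar> - k) + 1 / M * exp (- (2 * M * \<bar>y - \<eta>\<bar>))" if "y \<in> {0..1}" for y
    proof -
      have "y * (ln (cosh (M * (y - \<eta>))) / M) \<le> y * (\<bar>y - \<eta>\<bar> - k + exp (- (2 * M * \<bar>y - \<eta>\<bar>)) / M)"
        using upper[of "y - \<eta>"] that by (intro mult_left_mono) auto
      \<comment> \<open>The weight y \<le> 1 is dropped from the exponential to reach the integrand
        of the closed form.\<close>
      moreover have "y * (exp (- (2 * M * \<bar>y - \<eta>\<bar>)) / M) \<le> 1 * (exp (- (2 * M * \<bar>y - \<eta>\<bar>)) / M)"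
        using that M by (intro mult_right_mono) auto
      ultimately show ?thesis
        by (simp add: distrib_left)
    qed
  qed (use tanh_moment_by_parts M in auto)
  also have "\<dots> \<le> 1 / 3 - \<eta> / 2 + \<eta> ^ 3 / 3 - k / 2 + 1 / M\<^sup>2"
  proof -
    have "2 - exp (- (2 * M * \<eta>)) - exp (- (2 * M * (1 - \<eta>))) \<le> 2"
      using exp_ge_zero[of "- (2 * M * \<eta>)"] exp_ge_zero[of "- (2 * M * (1 - \<eta>))"] by linarith
    then have "1 / M * (2 - exp (- (2 * M * \<eta>)) - exp (- (2 * M * (1 - \<eta>)))) / (2 * M) \<le> 1 / M * 2 / (2 * M)"
      using M by (intro divide_right_mono mult_left_mono) auto
    then show ?thesis
      by (simp add: power2_eq_square)
  qed
  finally have "tanh_moment M \<eta>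
      - (insolation 1 * (ln (cosh (M * (1 - \<eta>))) / M) - insolation 0 * (ln (cosh (M * \<eta>)) / M))
    \<le> (1 / 3 - \<eta> / 2 + \<eta> ^ 3 / 3 - k / 2 + 1 / M\<^sup>2) * (1446 / 1000)"
    by (rule pos_divide_le_eq[THEN iffD1, rotated]) simp
  moreover have "X - (a * p - b * q) \<le> (E + r) * c \<Longrightarrow> X \<le> a * p - b * q + c * E + c * r" for X a b c p q r E :: real
    by (simp add: algebra_simps)
  ultimately have "tanh_moment M \<eta> \<le> 518 / 1000 * (ln (cosh (M * (1 - \<eta>))) / M) - 1241 / 1000 * (ln (cosh (M * \<eta>)) / M)
      + 1446 / 1000 * (1 / 3 - \<eta> / 2 + \<eta> ^ 3 / 3 - k / 2) + 1446 / 1000 * (1 / M\<^sup>2)"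
    unfolding insolation_0 insolation_1 by blast
  also have "\<dots> \<le> 518 / 1000 * (1 - \<eta> - k + exp (- (2 * M * (1 - \<eta>))) / M) - 1241 / 1000 * (\<eta> - k)
      + 1446 / 1000 * (1 / 3 - \<eta> / 2 + \<eta> ^ 3 / 3 - k / 2) + 1446 / 1000 * (1 / M\<^sup>2)"
    using L0 L1 by (intro add_right_mono diff_mono mult_left_mono) auto
  also have "\<dots> = 1 - 2 * (1241 / 1000 * \<eta> - 241 / 1000 * \<eta> ^ 3)
    + 518 / 1000 * exp (- (2 * M * (1 - \<eta>))) / M + 1446 / 1000 / M\<^sup>2"
    using M by (simp add: field_simps)
  finally show ?thesis .
qed

text \<open>As tanh (M (y - \<eta>)) changes sign at y = \<eta>, the integrand lies between - y and
  0 on [0, \<eta>] and between 0 and y on [\<eta>, 1].\<close>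

lemma tanh_moment_slope_bounds:
  assumes M: "M > 0" and \<eta>: "\<eta> \<in> {0..1}"
  shows "tanh_moment_slope M \<eta> \<le> 2482 / 1000 - 723 / 1000 * \<eta>\<^sup>2"
    and "518 / 1000 * tanh (M * (1 - \<eta>)) + 1241 / 1000 * tanh (M * \<eta>) - 723 / 1000 * \<eta>\<^sup>2 \<le> tanh_moment_slope M \<eta>"
proof -
  let ?f = "\<lambda>y. y * tanh (M * (y - \<eta>))"
  have int: "?f integrable_on {a..b}" for a b
    by (intro integrable_continuous_real continuous_intros) auto
  have split: "integral {0..1} ?f = integral {0..\<eta>} ?f + integral {\<eta>..1} ?f"
    using Henstock_Kurzweil_Integration.integral_combine[where a=0 and b=1 and c=\<eta> and f="?f"] \<eta> int by auto
  have id: "((\<lambda>y. y) has_integral b\<^sup>2 / 2 - a\<^sup>2 / 2) {a..b}" if "a \<le> b" for a b :: real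
    using that by (intro fundamental_theorem_of_calculus)
      (auto intro!: derivative_eq_intros simp: has_real_derivative_iff_has_vector_derivative[symmetric])
  have left_lower: "- (\<eta>\<^sup>2 / 2) \<le> integral {0..\<eta>} ?f"
  proof (rule has_integral_le)
    show "((\<lambda>y. - y) has_integral - (\<eta>\<^sup>2 / 2)) {0..\<eta>}"
      using has_integral_neg[OF id[of 0 \<eta>]] \<eta> by simp
    show "- y \<le> ?f y" if "y \<in> {0..\<eta>}" for y
      using mult_left_mono[of "- 1" "tanh (M * (y - \<eta>))" y] that tanh_real_gt_neg1[of "M * (y - \<eta>)"] by auto
  qed (use int in \<open>auto intro: integrable_integral\<close>)
  have right_upper: "integral {\<eta>..1} ?f \<le> 1 / 2 - \<eta>\<^sup>2 / 2"
  proof (rule has_integral_le)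
    show "((\<lambda>y. y) has_integral 1 / 2 - \<eta>\<^sup>2 / 2) {\<eta>..1}"
      using id[of \<eta> 1] \<eta> by simp
    show "?f y \<le> y" if "y \<in> {\<eta>..1}" for y
      using mult_left_mono[of "tanh (M * (y - \<eta>))" 1 y] that \<eta> tanh_real_lt_1[of "M * (y - \<eta>)"] by auto
  qed (use int in \<open>auto intro: integrable_integral\<close>)
  have left_upper: "integral {0..\<eta>} ?f \<le> 0"
  proof (rule has_integral_le[where i="integral {0..\<eta>} ?f" and f="?f" and g="\<lambda>_. 0"])
    show "?f y \<le> 0" if "y \<in> {0..\<eta>}" for y
      using that M by (intro mult_nonneg_nonpos) (auto intro: mult_nonneg_nonpos)
  qed (use int in \<open>auto intro: integrable_integral\<close>)
  have right_lower: "0 \<le> integral {\<eta>..1} ?f"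
    using M \<eta> by (intro integral_nonneg int) (auto intro!: mult_nonneg_nonneg)
  show "tanh_moment_slope M \<eta> \<le> 2482 / 1000 - 723 / 1000 * \<eta>\<^sup>2"
    using split left_upper right_upper tanh_real_lt_1[of "M * (1 - \<eta>)"] tanh_real_lt_1[of "M * \<eta>"]
    unfolding tanh_moment_slope_def insolation_0 insolation_1 by linarith
  show "518 / 1000 * tanh (M * (1 - \<eta>)) + 1241 / 1000 * tanh (M * \<eta>) - 723 / 1000 * \<eta>\<^sup>2 \<le> tanh_moment_slope M \<eta>"
    using split left_lower right_lower unfolding tanh_moment_slope_def insolation_0 insolation_1 by linarith
qed

section \<open>The equilibrium temperature at the ice line\<close>

text \<open>At y = \<eta> the tanh in the albedo vanishes, so M enters through the mean
  alone.\<close>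

lemma T_star_diagonal:
  "T_star p \<eta> \<eta> = (pQ p * insolation \<eta> * (1 - (p\<alpha>\<^sub>1 p + p\<alpha>\<^sub>2 p) / 2) - pA p
     + pC p / pB p * (pQ p * mean_absorbed p \<eta> - pA p)) / (pB p + pC p)"
  by (simp add: T_star_def albedo_def)

text \<open>The first term is the change of the mean absorbed radiation with the ice line, the
  second the change of the insolation at the ice line itself; their balance decides the
  sign.\<close>

definition diagonal_slope :: "ice_line_params \<Rightarrow> real \<Rightarrow> real" where
  "diagonal_slope p \<eta> = pQ p * (pC p / pB p * ((p\<alpha>\<^sub>2 p - p\<alpha>\<^sub>1 p) / 2 * tanh_moment_slope (pM p) \<eta>)
     - 1446 / 1000 * \<eta> * (1 - (p\<alpha>\<^sub>1 p + p\<alpha>\<^sub>2 p) / 2)) / (pB p + pC p)"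

lemma T_star_diagonal_deriv:
  "((\<lambda>\<eta>. T_star p \<eta> \<eta>) has_real_derivative diagonal_slope p \<eta>) (at \<eta>)"
proof -
  have "((\<lambda>\<eta>. Q * (1241 / 1000 - 723 / 1000 * \<eta>\<^sup>2) * (1 - a) - A + c * (Q * (1 - a - g * tanh_moment M \<eta>) - A))
      has_real_derivative Q * (c * (g * tanh_moment_slope M \<eta>) - 1446 / 1000 * \<eta> * (1 - a))) (at \<eta>)" for Q a A c g M
    by (auto intro!: derivative_eq_intros tanh_moment_deriv simp: field_simps)
  then show ?thesis
    unfolding T_star_diagonal mean_absorbed_eq insolation_eq diagonal_slope_def by (rule DERIV_cdivide)
qed

section \<open>Contraction towards the equilibrium profile\<close>

lemma abs_le_sup_norm:
  assumes "continuous_on {0..1} f" "y \<in> {0..1}"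
  shows "\<bar>f y\<bar> \<le> sup_norm f"
  unfolding sup_norm_def
proof (rule cSUP_upper[OF assms(2)])
  show "bdd_above ((\<lambda>y. \<bar>f y\<bar>) ` {0..1})"
    by (intro bounded_imp_bdd_above compact_imp_bounded compact_continuous_image
        continuous_intros assms(1) compact_Icc)
qed

lemma sup_norm_le: "(\<And>y. y \<in> {0..1} \<Longrightarrow> \<bar>f y\<bar> \<le> c) \<Longrightarrow> sup_norm f \<le> c"
  unfolding sup_norm_def by (rule cSUP_least) auto

lemma state_dist_nonneg: "0 \<le> state_dist x z"
  by (simp add: state_dist_def le_max_iff_disj)

lemma continuous_on_albedo [continuous_intros]: "continuous_on S (albedo p \<eta>)"
  unfolding albedo_def by (intro continuous_intros) auto

lemma continuous_on_T_star [continuous_intros]: "continuous_on S (T_star p \<eta>)"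
  unfolding T_star_def divide_inverse by (intro continuous_intros)

lemma has_integral_mean_absorbed:
  "((\<lambda>y. insolation y * (1 - albedo p \<eta> y)) has_integral mean_absorbed p \<eta>) {0..1}"
  unfolding mean_absorbed_def
  by (intro integrable_integral integrable_continuous_real continuous_intros)

section \<open>The lag of the profile behind its equilibrium\<close>

text \<open>B + C \<le> R keeps the coefficient 1 - (B + C) / R of the local deviation nonnegative,
  so that the contraction factors add up to 1 - B / R.\<close>

locale dissipative_ice_line =
  fixes p :: ice_line_params
  assumes B_pos: "0 < pB p" and C_nonneg: "0 \<le> pC p" and R_large: "pB p + pC p \<le> pR p"
begin

text \<open>With an upper bound for the deviation in place of its sup norm, the yearly recursion
  follows from pointwise triangle inequalities.\<close>

definition lag_bound :: "state \<Rightarrow> real \<Rightarrow> bool" where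
  "lag_bound x u \<longleftrightarrow> 0 \<le> u \<and> (\<forall>y\<in>{0..1}. \<bar>fst x y - T_star p (snd x) y\<bar> \<le> u)"

definition contraction_rate :: real where
  "contraction_rate = 1 - pB p / pR p"

text \<open>A Lipschitz constant of \<open>T_star p\<close> in \<open>\<eta>\<close>; the insolation is crudely bounded by \<open>2\<close>.\<close>

definition drift :: real where
  "drift = \<bar>pQ p * (p\<alpha>\<^sub>2 p - p\<alpha>\<^sub>1 p) * pM p\<bar> * (1 + pC p / pB p) / (pB p + pC p)"

lemma R_pos: "0 < pR p"
  using B_pos C_nonneg R_large by linarith

lemma contraction_rate_bounds: "0 \<le> contraction_rate" "contraction_rate < 1"
  using B_pos C_nonneg R_large R_pos by (auto simp: contraction_rate_def)

lemma drift_nonneg: "0 \<le> drift"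
  using B_pos C_nonneg by (simp add: drift_def)

text \<open>Transport only redistributes heat, so C drops out of the mean temperature.\<close>

lemma has_integral_T_star:
  "(T_star p \<eta> has_integral (pQ p * mean_absorbed p \<eta> - pA p) / pB p) {0..1}"
proof -
  have "((\<lambda>y. (pQ p * (insolation y * (1 - albedo p \<eta> y)) +
        (pC p / pB p * (pQ p * mean_absorbed p \<eta> - pA p) - pA p)) / (pB p + pC p))
      has_integral (pQ p * mean_absorbed p \<eta> +
        (pC p / pB p * (pQ p * mean_absorbed p \<eta> - pA p) - pA p)) / (pB p + pC p)) {0..1}"
    using has_integral_const_real[of "pC p / pB p * (pQ p * mean_absorbed p \<eta> - pA p) - pA p" 0 1]
    by (intro has_integral_divide has_integral_add has_integral_mult_right has_integral_mean_absorbed) auto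
  moreover have "(pQ p * mean_absorbed p \<eta> +
        (pC p / pB p * (pQ p * mean_absorbed p \<eta> - pA p) - pA p)) / (pB p + pC p)
      = (pQ p * mean_absorbed p \<eta> - pA p) / pB p"
    using B_pos C_nonneg by (simp add: divide_simps) (simp add: algebra_simps)
  moreover have "T_star p \<eta> = (\<lambda>y. (pQ p * (insolation y * (1 - albedo p \<eta> y)) +
        (pC p / pB p * (pQ p * mean_absorbed p \<eta> - pA p) - pA p)) / (pB p + pC p))"
    by (rule ext) (simp add: T_star_def algebra_simps)
  ultimately show ?thesis
    by simp
qed

text \<open>Let E = T - \<open>T_star p \<eta>\<close> and let I be its integral. R times the
  increment equals C I - (B + C) E, so the new deviation is (1 - (B + C) / R) E + (C / R) I, where
  |I| \<le> u.\<close>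

lemma lag_contracts:
  assumes T: "continuous_on {0..1} T" and u: "\<And>y. y \<in> {0..1} \<Longrightarrow> \<bar>T y - T_star p \<eta> y\<bar> \<le> u"
    and y: "y \<in> {0..1}"
  shows "\<bar>T y + temp_increment p (T, \<eta>) y - T_star p \<eta> y\<bar> \<le> contraction_rate * u"
proof -
  let ?E = "\<lambda>y. T y - T_star p \<eta> y"
  let ?I = "integral {0..1} ?E"
  have T_int: "(T has_integral integral {0..1} T) {0..1}"
    by (intro integrable_integral integrable_continuous_real T)
  have E_int: "(?E has_integral integral {0..1} T - (pQ p * mean_absorbed p \<eta> - pA p) / pB p) {0..1}"
    by (intro has_integral_diff T_int has_integral_T_star)
  then have I_eq: "?I = integral {0..1} T - (pQ p * mean_absorbed p \<eta> - pA p) / pB p"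
    by (rule integral_unique)
  have "norm ?I \<le> integral {0..1::real} (\<lambda>_. u)"
    by (rule integral_norm_bound_integral[OF has_integral_integrable[OF E_int]]) (use u in auto)
  then have I_le: "\<bar>?I\<bar> \<le> u"
    by simp
  have balance: "(pB p + pC p) * T_star p \<eta> y = pQ p * insolation y * (1 - albedo p \<eta> y) - pA p
      + pC p * ((pQ p * mean_absorbed p \<eta> - pA p) / pB p)"
    using B_pos C_nonneg by (simp add: T_star_def)
  have "pR p * temp_increment p (T, \<eta>) y = pC p * ?I - (pB p + pC p) * ?E y"
    using R_pos balance unfolding I_eq by (simp add: temp_increment_def algebra_simps)
  then have "temp_increment p (T, \<eta>) y = (pC p * ?I - (pB p + pC p) * ?E y) / pR p"
    using R_pos by (simp add: field_simps)
  then have "T y + temp_increment p (T, \<eta>) y - T_star p \<eta> y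
      = (1 - (pB p + pC p) / pR p) * ?E y + pC p / pR p * ?I"
    by (simp add: left_diff_distrib diff_divide_distrib)
  moreover have "\<bar>(1 - (pB p + pC p) / pR p) * ?E y\<bar> \<le> (1 - (pB p + pC p) / pR p) * u"
    using u[OF y] R_large R_pos by (simp add: abs_mult mult_left_mono)
  moreover have "\<bar>pC p / pR p * ?I\<bar> \<le> pC p / pR p * u"
    using I_le C_nonneg R_pos unfolding abs_mult by (simp add: divide_right_mono mult_left_mono)
  ultimately have "\<bar>T y + temp_increment p (T, \<eta>) y - T_star p \<eta> y\<bar>
      \<le> (1 - (pB p + pC p) / pR p) * u + pC p / pR p * u"
    by linarith
  also have "\<dots> = contraction_rate * u"
    by (simp add: contraction_rate_def add_divide_distrib algebra_simps)
  finally show ?thesis .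
qed

text \<open>The albedo is Lipschitz in \<eta> through tanh and the mean inherits the constant;
  \<open>drift\<close> collects the local term and C / B times the mean term.\<close>

lemma T_star_lipschitz:
  assumes "y \<in> {0..1}"
  shows "\<bar>T_star p \<eta> y - T_star p \<eta>' y\<bar> \<le> drift * \<bar>\<eta> - \<eta>'\<bar>"
proof -
  let ?f = "\<lambda>\<eta> y. insolation y * (1 - albedo p \<eta> y)"
  define a where "a = \<bar>(p\<alpha>\<^sub>2 p - p\<alpha>\<^sub>1 p) * pM p\<bar>"
  have f: "\<bar>?f \<eta> y - ?f \<eta>' y\<bar> \<le> a * \<bar>\<eta> - \<eta>'\<bar>" if "y \<in> {0..1}" for y
  proof -
    have "y\<^sup>2 \<le> 1"
      using that by (simp add: abs_square_le_1)
    then have s: "\<bar>insolation y\<bar> \<le> 2"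
      unfolding insolation_eq using zero_le_power2[of y] by (intro abs_leI) linarith+
    have "\<bar>tanh (pM p * (y - \<eta>')) - tanh (pM p * (y - \<eta>))\<bar> \<le> \<bar>pM p\<bar> * \<bar>\<eta> - \<eta>'\<bar>"
      using tanh_lipschitz[of "pM p * (y - \<eta>')" "pM p * (y - \<eta>)"]
      by (simp add: abs_mult[symmetric] algebra_simps)
    then have "\<bar>(p\<alpha>\<^sub>2 p - p\<alpha>\<^sub>1 p) / 2\<bar> * \<bar>tanh (pM p * (y - \<eta>')) - tanh (pM p * (y - \<eta>))\<bar>
        \<le> \<bar>(p\<alpha>\<^sub>2 p - p\<alpha>\<^sub>1 p) / 2\<bar> * (\<bar>pM p\<bar> * \<bar>\<eta> - \<eta>'\<bar>)"
      by (rule mult_left_mono) simp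
    then have "\<bar>insolation y\<bar> * (\<bar>(p\<alpha>\<^sub>2 p - p\<alpha>\<^sub>1 p) / 2\<bar> * \<bar>tanh (pM p * (y - \<eta>')) - tanh (pM p * (y - \<eta>))\<bar>)
        \<le> 2 * (\<bar>(p\<alpha>\<^sub>2 p - p\<alpha>\<^sub>1 p) / 2\<bar> * (\<bar>pM p\<bar> * \<bar>\<eta> - \<eta>'\<bar>))"
      by (rule mult_mono[OF s]) auto
    also have "\<dots> = a * \<bar>\<eta> - \<eta>'\<bar>"
      by (simp add: abs_mult a_def)
    finally have "\<bar>insolation y * ((p\<alpha>\<^sub>2 p - p\<alpha>\<^sub>1 p) / 2 * (tanh (pM p * (y - \<eta>')) - tanh (pM p * (y - \<eta>))))\<bar>
        \<le> a * \<bar>\<eta> - \<eta>'\<bar>"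
      by (simp only: abs_mult)
    moreover have "?f \<eta> y - ?f \<eta>' y
        = insolation y * ((p\<alpha>\<^sub>2 p - p\<alpha>\<^sub>1 p) / 2 * (tanh (pM p * (y - \<eta>')) - tanh (pM p * (y - \<eta>))))"
      by (simp add: albedo_def right_diff_distrib left_diff_distrib diff_divide_distrib distrib_left)
    ultimately show ?thesis
      by (simp only:)
  qed
  have "norm (integral {0..1} (\<lambda>y. ?f \<eta> y - ?f \<eta>' y)) \<le> integral {0..1::real} (\<lambda>y. a * \<bar>\<eta> - \<eta>'\<bar>)"
    by (rule integral_norm_bound_integral)
      (use f in \<open>auto intro!: integrable_continuous_real continuous_intros\<close>)
  moreover have "integral {0..1} (\<lambda>y. ?f \<eta> y - ?f \<eta>' y) = mean_absorbed p \<eta> - mean_absorbed p \<eta>'"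
    by (intro integral_unique has_integral_diff has_integral_mean_absorbed)
  ultimately have m: "\<bar>mean_absorbed p \<eta> - mean_absorbed p \<eta>'\<bar> \<le> a * \<bar>\<eta> - \<eta>'\<bar>"
    by simp
  have "(Q * s * t - A + c * (Q * m - A)) / D - (Q * s * t' - A + c * (Q * m' - A)) / D
      = Q * ((s * t - s * t') + c * (m - m')) / D" for Q A c D s t t' m m' :: real
    by (simp add: diff_divide_distrib[symmetric] algebra_simps)
  then have "T_star p \<eta> y - T_star p \<eta>' y = pQ p *
      ((?f \<eta> y - ?f \<eta>' y) + pC p / pB p * (mean_absorbed p \<eta> - mean_absorbed p \<eta>')) / (pB p + pC p)"
    unfolding T_star_def .
  moreover have "\<bar>(?f \<eta> y - ?f \<eta>' y) + pC p / pB p * (mean_absorbed p \<eta> - mean_absorbed p \<eta>')\<bar>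
      \<le> a * \<bar>\<eta> - \<eta>'\<bar> + pC p / pB p * (a * \<bar>\<eta> - \<eta>'\<bar>)"
  proof (rule order_trans[OF abs_triangle_ineq add_mono[OF f[OF assms]]])
    show "\<bar>pC p / pB p * (mean_absorbed p \<eta> - mean_absorbed p \<eta>')\<bar> \<le> pC p / pB p * (a * \<bar>\<eta> - \<eta>'\<bar>)"
      using m B_pos C_nonneg unfolding abs_mult by (simp add: divide_right_mono mult_left_mono)
  qed
  ultimately have "\<bar>T_star p \<eta> y - T_star p \<eta>' y\<bar>
      \<le> \<bar>pQ p\<bar> * (a * \<bar>\<eta> - \<eta>'\<bar> + pC p / pB p * (a * \<bar>\<eta> - \<eta>'\<bar>)) / (pB p + pC p)"
    using B_pos C_nonneg by (simp add: abs_mult divide_right_mono mult_left_mono)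
  also have "\<dots> = drift * \<bar>\<eta> - \<eta>'\<bar>"
    by (simp add: drift_def a_def abs_mult distrib_left distrib_right add_divide_distrib mult_ac)
  finally show ?thesis .
qed

lemma year_in_states:
  assumes "x \<in> states"
  shows "year p \<epsilon> x \<in> states"
proof -
  obtain T \<eta> where x: "x = (T, \<eta>)" "continuous_on {0..1} T" "\<eta> \<in> {0..1}"
    using assms by (auto simp: states_def)
  have "continuous_on {0..1} (\<lambda>y. T y + temp_increment p (T, \<eta>) y)"
    unfolding temp_increment_def case_prod_conv using x(2) by (intro continuous_intros) auto
  then show ?thesis
    by (auto simp: year_def states_def x(1))
qed

text \<open>First the profile contracts towards the equilibrium of the old ice line, then this
  equilibrium moves with the ice line.\<close>

lemma lag_bound_year:
  assumes x: "x \<in> states" and u: "lag_bound x u"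
  shows "lag_bound (year p \<epsilon> x) (contraction_rate * u + drift * \<bar>snd (year p \<epsilon> x) - snd x\<bar>)"
  unfolding lag_bound_def
proof (intro conjI ballI)
  show "0 \<le> contraction_rate * u + drift * \<bar>snd (year p \<epsilon> x) - snd x\<bar>"
    using u contraction_rate_bounds drift_nonneg by (auto simp: lag_bound_def)
  fix y :: real assume y: "y \<in> {0..1}"
  have "\<bar>fst (year p \<epsilon> x) y - T_star p (snd x) y\<bar> \<le> contraction_rate * u"
    using lag_contracts[of "fst x" "snd x" u y] x u y
    by (auto simp: year_def states_def lag_bound_def)
  moreover have "\<bar>T_star p (snd x) y - T_star p (snd (year p \<epsilon> x)) y\<bar> \<le> drift * \<bar>snd (year p \<epsilon> x) - snd x\<bar>"
    using T_star_lipschitz[OF y, of "snd x" "snd (year p \<epsilon> x)"] by (simp add: abs_minus_commute)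
  ultimately show "\<bar>fst (year p \<epsilon> x) y - T_star p (snd (year p \<epsilon> x)) y\<bar>
      \<le> contraction_rate * u + drift * \<bar>snd (year p \<epsilon> x) - snd x\<bar>"
    by linarith
qed

text \<open>Together with \<open>state_dist_of_lag_bound\<close> this lets the lag and the ice line
  displacement replace the distance, up to constants.\<close>

lemma lag_bound_of_state_dist:
  assumes "x \<in> states" "state_dist x (T_star p \<eta>\<^sub>0, \<eta>\<^sub>0) < \<delta>"
  shows "lag_bound x ((1 + drift) * \<delta>)" and "\<bar>snd x - \<eta>\<^sub>0\<bar> < \<delta>"
proof -
  show e: "\<bar>snd x - \<eta>\<^sub>0\<bar> < \<delta>"
    using assms(2) by (simp add: state_dist_def)
  have "\<bar>fst x y - T_star p (snd x) y\<bar> \<le> (1 + drift) * \<delta>" if y: "y \<in> {0..1}" for y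
  proof -
    have "continuous_on {0..1} (fst x)"
      using assms(1) by (auto simp: states_def)
    then have "\<bar>fst x y - T_star p \<eta>\<^sub>0 y\<bar> \<le> sup_norm (\<lambda>y. fst x y - T_star p \<eta>\<^sub>0 y)"
      by (intro abs_le_sup_norm[OF _ y] continuous_intros)
    then have "\<bar>fst x y - T_star p \<eta>\<^sub>0 y\<bar> \<le> \<delta>"
      using assms(2) by (simp add: state_dist_def)
    moreover have "\<bar>T_star p \<eta>\<^sub>0 y - T_star p (snd x) y\<bar> \<le> drift * \<delta>"
      using T_star_lipschitz[OF y, of \<eta>\<^sub>0 "snd x"] e mult_left_mono[OF _ drift_nonneg, of "\<bar>\<eta>\<^sub>0 - snd x\<bar>" \<delta>]
      by (simp add: abs_minus_commute)
    ultimately show ?thesis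
      by (simp add: distrib_right)
  qed
  then show "lag_bound x ((1 + drift) * \<delta>)"
    using e drift_nonneg by (simp add: lag_bound_def)
qed

lemma state_dist_of_lag_bound:
  assumes "lag_bound x u"
  shows "state_dist x (T_star p \<eta>\<^sub>0, \<eta>\<^sub>0) \<le> u + (1 + drift) * \<bar>snd x - \<eta>\<^sub>0\<bar>"
proof -
  have "sup_norm (\<lambda>y. fst x y - T_star p \<eta>\<^sub>0 y) \<le> u + drift * \<bar>snd x - \<eta>\<^sub>0\<bar>"
  proof (rule sup_norm_le)
    fix y :: real assume y: "y \<in> {0..1}"
    show "\<bar>fst x y - T_star p \<eta>\<^sub>0 y\<bar> \<le> u + drift * \<bar>snd x - \<eta>\<^sub>0\<bar>"
      using assms y T_star_lipschitz[OF y, of "snd x" \<eta>\<^sub>0] unfolding lag_bound_def by fastforce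
  qed
  moreover have "0 \<le> u" "0 \<le> drift * \<bar>snd x - \<eta>\<^sub>0\<bar>"
    using assms drift_nonneg by (auto simp: lag_bound_def)
  ultimately show ?thesis
    by (simp add: state_dist_def distrib_right)
qed

section \<open>A Lyapunov criterion for stability\<close>

text \<open>Writing e for the displacement of the ice line, \<open>lag_bound_year\<close> gives e' +
  w u' \<le> (1 - a + w drift c) e + (b + w (rate + drift d)) u. The hypotheses \<open>w\<close> put
  the two coefficients below 1 and below w, so e + w u decays geometrically.\<close>

lemma stable_if_ice_line_contracts:
  assumes "0 < w" "0 < \<rho>"
    and w: "w * (drift * c) < a" "b + w * (contraction_rate + drift * d) < w"
    and ice: "\<And>x u. x \<in> states \<Longrightarrow> lag_bound x u \<Longrightarrow> \<bar>snd x - \<eta>\<^sub>0\<bar> \<le> \<rho> \<Longrightarrow> u \<le> \<rho> \<Longrightarrow>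
      \<bar>snd (year p \<epsilon> x) - \<eta>\<^sub>0\<bar> \<le> (1 - a) * \<bar>snd x - \<eta>\<^sub>0\<bar> + b * u \<and>
      \<bar>snd (year p \<epsilon> x) - snd x\<bar> \<le> c * \<bar>snd x - \<eta>\<^sub>0\<bar> + d * u"
  shows "stable_state p \<epsilon> (T_star p \<eta>\<^sub>0, \<eta>\<^sub>0)"
proof -
  let ?z = "(T_star p \<eta>\<^sub>0, \<eta>\<^sub>0)"
  define V where "V v x \<longleftrightarrow> x \<in> states \<and> (\<exists>u. lag_bound x u \<and> \<bar>snd x - \<eta>\<^sub>0\<bar> + w * u \<le> v)" for v x
  define \<kappa> where "\<kappa> = max (1 - a + w * (drift * c)) ((b + w * (contraction_rate + drift * d)) / w)"
  \<comment> \<open>Where the Lyapunov function is at most \<sigma>, both e and u are at most \<rho>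
    and the hypothesis \<open>ice\<close> applies.\<close>
  define \<sigma> where "\<sigma> = min \<rho> (w * \<rho>)"
  define m where "m = 1 / w + (1 + drift)"
  have \<kappa>1: "\<kappa> < 1"
    using w \<open>0 < w\<close> by (simp add: \<kappa>_def)
  \<comment> \<open>\<kappa> may be negative; a nonnegative rate is taken so that the estimate can
    be iterated.\<close>
  define \<theta> where "\<theta> = max 0 \<kappa>"
  have \<theta>: "0 \<le> \<theta>" "\<theta> < 1" "\<kappa> \<le> \<theta>"
    using \<kappa>1 by (auto simp: \<theta>_def)
  have \<sigma>: "0 < \<sigma>"
    using assms(1,2) by (simp add: \<sigma>_def)
  have m: "0 < m"
    using assms(1) drift_nonneg by (auto simp: m_def intro: add_pos_nonneg)
  have step: "V (\<theta> * v) (year p \<epsilon> x)" if V: "V v x" and v: "v \<le> \<sigma>" for v x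
  proof -
    obtain u where x: "x \<in> states" and u: "lag_bound x u" and le: "\<bar>snd x - \<eta>\<^sub>0\<bar> + w * u \<le> v"
      using V by (auto simp: V_def)
    have "0 \<le> u"
      using u by (simp add: lag_bound_def)
    have "\<bar>snd x - \<eta>\<^sub>0\<bar> \<le> \<rho>"
      using le v mult_nonneg_nonneg[of w u] \<open>0 \<le> u\<close> \<open>0 < w\<close> unfolding \<sigma>_def by linarith
    moreover have "u \<le> \<rho>"
    proof -
      have "w * u \<le> w * \<rho>"
        using le v unfolding \<sigma>_def by linarith
      then show ?thesis
        using \<open>0 < w\<close> by simp
    qed
    ultimately have e': "\<bar>snd (year p \<epsilon> x) - \<eta>\<^sub>0\<bar> \<le> (1 - a) * \<bar>snd x - \<eta>\<^sub>0\<bar> + b * u"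
      and d': "\<bar>snd (year p \<epsilon> x) - snd x\<bar> \<le> c * \<bar>snd x - \<eta>\<^sub>0\<bar> + d * u"
      using ice[OF x u] by auto
    let ?u' = "contraction_rate * u + drift * \<bar>snd (year p \<epsilon> x) - snd x\<bar>"
    have "?u' \<le> contraction_rate * u + drift * (c * \<bar>snd x - \<eta>\<^sub>0\<bar> + d * u)"
      using d' drift_nonneg by (intro add_left_mono mult_left_mono)
    then have "w * ?u' \<le> w * (contraction_rate * u + drift * (c * \<bar>snd x - \<eta>\<^sub>0\<bar> + d * u))"
      using \<open>0 < w\<close> by simp
    then have "\<bar>snd (year p \<epsilon> x) - \<eta>\<^sub>0\<bar> + w * ?u'
        \<le> (1 - a) * \<bar>snd x - \<eta>\<^sub>0\<bar> + b * u
          + w * (contraction_rate * u + drift * (c * \<bar>snd x - \<eta>\<^sub>0\<bar> + d * u))"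
      using e' by linarith
    also have "\<dots> = (1 - a + w * (drift * c)) * \<bar>snd x - \<eta>\<^sub>0\<bar>
        + (b + w * (contraction_rate + drift * d)) / w * (w * u)"
      using \<open>0 < w\<close> by (simp add: field_simps)
    also have "\<dots> \<le> \<kappa> * \<bar>snd x - \<eta>\<^sub>0\<bar> + \<kappa> * (w * u)"
      using \<open>0 < w\<close> \<open>0 \<le> u\<close> by (intro add_mono mult_right_mono) (auto simp: \<kappa>_def)
    also have "\<dots> = \<kappa> * (\<bar>snd x - \<eta>\<^sub>0\<bar> + w * u)"
      by (simp add: distrib_left)
    also have "\<dots> \<le> \<theta> * (\<bar>snd x - \<eta>\<^sub>0\<bar> + w * u)"
      using \<theta> \<open>0 < w\<close> \<open>0 \<le> u\<close> by (intro mult_right_mono) auto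
    also have "\<dots> \<le> \<theta> * v"
      using le \<theta> by (intro mult_left_mono)
    finally show ?thesis
      using lag_bound_year[OF x u] year_in_states[OF x] by (auto simp: V_def)
  qed
  have V_funpow: "V (\<theta> ^ n * v) ((year p \<epsilon> ^^ n) x)" if "V v x" "0 \<le> v" "v \<le> \<sigma>" for v x n
  proof (induction n)
    case (Suc n)
    have "\<theta> ^ n * v \<le> 1 * v"
      using \<theta> that by (intro mult_right_mono power_le_one) auto
    then show ?case
      using step[OF Suc] that by (simp add: mult.assoc)
  qed (use that in simp)
  have V_dist: "state_dist x ?z \<le> m * v" if V: "V v x" for v x
  proof -
    obtain u where u: "lag_bound x u" and le: "\<bar>snd x - \<eta>\<^sub>0\<bar> + w * u \<le> v"
      using V by (auto simp: V_def)
    have "0 \<le> u"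
      using u by (simp add: lag_bound_def)
    then have wu: "0 \<le> w * u"
      using \<open>0 < w\<close> by simp
    have "state_dist x ?z \<le> 1 / w * (w * u) + (1 + drift) * \<bar>snd x - \<eta>\<^sub>0\<bar>"
      using state_dist_of_lag_bound[OF u] \<open>0 < w\<close> by simp
    also have "\<dots> \<le> 1 / w * v + (1 + drift) * v"
      using \<open>0 < w\<close> drift_nonneg le wu by (intro add_mono mult_left_mono) auto
    finally show ?thesis
      by (simp add: m_def distrib_right)
  qed
  \<comment> \<open>k and m compare the Lyapunov function with \<open>state_dist\<close> in the two
    directions.\<close>
  define k where "k = 1 + w * (1 + drift)"
  have k: "0 < k"
    using \<open>0 < w\<close> drift_nonneg by (auto simp: k_def intro: add_pos_nonneg)
  have dist_V: "V (k * \<delta>) x" if x: "x \<in> states" "state_dist x ?z < \<delta>" for x \<delta>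
  proof -
    have "\<bar>snd x - \<eta>\<^sub>0\<bar> + w * ((1 + drift) * \<delta>) \<le> k * \<delta>"
      using lag_bound_of_state_dist(2)[OF x] by (simp add: k_def algebra_simps)
    then show ?thesis
      using lag_bound_of_state_dist(1)[OF x] x(1) by (auto simp: V_def)
  qed
  have decay: "state_dist ((year p \<epsilon> ^^ n) x) ?z \<le> m * (\<theta> ^ n * (k * \<delta>))"
    if "x \<in> states" "state_dist x ?z < \<delta>" "k * \<delta> \<le> \<sigma>" for x \<delta> n
  proof -
    have "0 \<le> k * \<delta>"
      using state_dist_nonneg[of x ?z] that(2) k by (intro mult_nonneg_nonneg) auto
    then show ?thesis
      using V_dist V_funpow dist_V that by blast
  qed
  show ?thesis
    unfolding stable_state_def
  proof (intro conjI allI impI)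
    fix r :: real assume r: "0 < r"
    define \<delta> where "\<delta> = min \<sigma> (r / (2 * m)) / k"
    have k\<delta>: "k * \<delta> \<le> \<sigma>" "m * (k * \<delta>) < r" and \<delta>: "0 < \<delta>"
    proof -
      have "m * (k * \<delta>) \<le> m * (r / (2 * m))"
        using m k by (intro mult_left_mono) (auto simp: \<delta>_def)
      also have "\<dots> < r"
        using m r by simp
      finally show "m * (k * \<delta>) < r" .
    qed (use k \<sigma> m r in \<open>auto simp: \<delta>_def\<close>)
    have "state_dist ((year p \<epsilon> ^^ n) x) ?z < r" if x: "x \<in> states" "state_dist x ?z < \<delta>" for x n
    proof -
      have "\<theta> ^ n * (k * \<delta>) \<le> 1 * (k * \<delta>)"
        using \<theta> k \<delta> by (intro mult_right_mono power_le_one) auto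
      then have "m * (\<theta> ^ n * (k * \<delta>)) \<le> m * (k * \<delta>)"
        using m by simp
      then show ?thesis
        using decay[OF x k\<delta>(1), of n] k\<delta>(2) by linarith
    qed
    then show "\<exists>\<delta>>0. \<forall>x\<in>states. state_dist x ?z < \<delta> \<longrightarrow> (\<forall>n. state_dist ((year p \<epsilon> ^^ n) x) ?z < r)"
      using \<delta> by blast
  next
    have "(\<lambda>n. state_dist ((year p \<epsilon> ^^ n) x) ?z) \<longlonglongrightarrow> 0"
      if x: "x \<in> states" "state_dist x ?z < \<sigma> / k" for x
    proof (rule tendsto_sandwich[OF _ _ tendsto_const])
      show "\<forall>\<^sub>F n in sequentially. state_dist ((year p \<epsilon> ^^ n) x) ?z \<le> m * (\<theta> ^ n * (k * (\<sigma> / k)))"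
        using decay[OF x] k by simp
      have "(\<lambda>n. \<theta> ^ n) \<longlonglongrightarrow> 0"
        using \<theta> by (intro LIMSEQ_power_zero) auto
      then show "(\<lambda>n. m * (\<theta> ^ n * (k * (\<sigma> / k)))) \<longlonglongrightarrow> 0"
        by (intro tendsto_mult_right_zero tendsto_mult_left_zero)
    qed (simp add: state_dist_nonneg)
    then show "\<exists>\<delta>>0. \<forall>x\<in>states. state_dist x ?z < \<delta> \<longrightarrow>
        (\<lambda>n. state_dist ((year p \<epsilon> ^^ n) x) ?z) \<longlonglongrightarrow> 0"
      using \<sigma> k by (intro exI[of _ "\<sigma> / k"]) auto
  qed
qed

end

section \<open>Stability criteria\<close>

text \<open>Secant slopes near a lie within D / 2 of D. At x = a the equation is trivial and s = D
  serves.\<close>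

lemma DERIV_pos_two_sided_slope:
  fixes f :: "real \<Rightarrow> real"
  assumes f: "(f has_real_derivative D) (at a)" and D: "0 < D"
  obtains \<rho> where "0 < \<rho>" "\<And>x. \<bar>x - a\<bar> < \<rho> \<Longrightarrow> \<exists>s. D / 2 \<le> s \<and> s \<le> 2 * D \<and> f x - f a = s * (x - a)"
proof -
  have "(\<lambda>x. (f x - f a) / (x - a)) \<midarrow>a\<rightarrow> D"
    using f by (simp add: has_field_derivative_iff)
  from LIM_D[OF this, of "D / 2"] D obtain \<rho> where \<rho>: "0 < \<rho>"
    "\<And>x. x \<noteq> a \<Longrightarrow> \<bar>x - a\<bar> < \<rho> \<Longrightarrow> \<bar>(f x - f a) / (x - a) - D\<bar> < D / 2"
    by auto
  show thesis
  proof (rule that[OF \<rho>(1)])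
    fix x assume x: "\<bar>x - a\<bar> < \<rho>"
    show "\<exists>s. D / 2 \<le> s \<and> s \<le> 2 * D \<and> f x - f a = s * (x - a)"
    proof (cases "x = a")
      case True
      then show ?thesis
        using D by (intro exI[of _ D]) auto
    next
      case False
      have "\<bar>(f x - f a) / (x - a) - D\<bar> < D / 2"
        by (rule \<rho>(2)[OF False x])
      then have "D / 2 \<le> (f x - f a) / (x - a)" "(f x - f a) / (x - a) \<le> 2 * D"
        using D by linarith+
      then show ?thesis
        using False by (intro exI[of _ "(f x - f a) / (x - a)"]) auto
    qed
  qed
qed

text \<open>Stopping at the endpoints brings the ice line no farther from a point of [0,1], so upper
  bounds may be proved for the unstopped one.\<close>

lemma clip_nonexpansive: "\<bar>max 0 (min 1 x) - y\<bar> \<le> \<bar>x - y\<bar>" if "y \<in> {0..1}" for x y :: real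
  using that by auto

lemma snd_year_interior:
  assumes "0 < snd x" "snd x < 1"
  shows "snd (year p \<epsilon> x) = max 0 (min 1 (snd x + \<epsilon> * (fst x (snd x) - pT\<^sub>c p)))"
  using assms by (simp add: year_def ice_increment_def split_beta)

context dissipative_ice_line
begin

section \<open>Stable states\<close>

text \<open>The Lyapunov criterion is used with a = \<epsilon> |D| / 2, c = 2 \<epsilon> |D| and b =
  d = \<epsilon>. As a and c both scale with \<epsilon>, the weight w can be fixed first; for small
  \<epsilon> the contraction of the profile absorbs b and d.\<close>

lemma interior_equilibrium_stable:
  assumes \<eta>\<^sub>0: "0 < \<eta>\<^sub>0" "\<eta>\<^sub>0 < 1" and eq: "T_star p \<eta>\<^sub>0 \<eta>\<^sub>0 = pT\<^sub>c p"
    and deriv: "((\<lambda>\<eta>. T_star p \<eta> \<eta>) has_real_derivative D) (at \<eta>\<^sub>0)" and D: "D < 0"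
  obtains \<epsilon>\<^sub>0 where "0 < \<epsilon>\<^sub>0" "\<And>\<epsilon>. 0 < \<epsilon> \<Longrightarrow> \<epsilon> < \<epsilon>\<^sub>0 \<Longrightarrow> stable_state p \<epsilon> (T_star p \<eta>\<^sub>0, \<eta>\<^sub>0)"
proof -
  from DERIV_minus[OF deriv] D obtain \<rho>\<^sub>1 where \<rho>\<^sub>1: "0 < \<rho>\<^sub>1"
    and slope: "\<And>\<eta>. \<bar>\<eta> - \<eta>\<^sub>0\<bar> < \<rho>\<^sub>1 \<Longrightarrow>
      \<exists>s. - D / 2 \<le> s \<and> s \<le> 2 * - D \<and> - T_star p \<eta> \<eta> - - T_star p \<eta>\<^sub>0 \<eta>\<^sub>0 = s * (\<eta> - \<eta>\<^sub>0)"
    using DERIV_pos_two_sided_slope[of "\<lambda>\<eta>. - T_star p \<eta> \<eta>" "- D" \<eta>\<^sub>0] by auto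
  define \<rho> where "\<rho> = min (\<rho>\<^sub>1 / 2) (min (\<eta>\<^sub>0 / 2) ((1 - \<eta>\<^sub>0) / 2))"
  have \<rho>: "0 < \<rho>" "\<rho> < \<rho>\<^sub>1" "\<rho> < \<eta>\<^sub>0" "\<rho> < 1 - \<eta>\<^sub>0"
    using \<rho>\<^sub>1 \<eta>\<^sub>0 by (auto simp: \<rho>_def min_less_iff_disj)
  \<comment> \<open>The + 1 keeps the denominator positive when \<open>drift\<close> is 0 and makes
    \<open>wK\<close> strict.\<close>
  define w where "w = (- D / 2) / (drift * (2 * - D) + 1)"
  have den: "0 < drift * (2 * - D) + 1"
    using D drift_nonneg by (intro add_nonneg_pos mult_nonneg_nonneg) auto
  have w: "0 < w"
    using den D unfolding w_def by (intro divide_pos_pos) auto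
  have wK: "w * (drift * (2 * - D)) < - D / 2"
  proof -
    have "w * (drift * (2 * - D) + 1) = - D / 2"
      by (rule nonzero_eq_divide_eq[THEN iffD1, OF less_imp_neq[OF den, symmetric] w_def])
    then show ?thesis
      using w unfolding distrib_left by linarith
  qed
  have wd: "0 < 1 + w * drift"
    using w drift_nonneg by (intro add_pos_nonneg mult_nonneg_nonneg) auto
  define \<epsilon>\<^sub>0 where "\<epsilon>\<^sub>0 = min (1 / (2 * - D)) (w * (1 - contraction_rate) / (1 + w * drift))"
  show thesis
  proof (rule that)
    show "0 < \<epsilon>\<^sub>0"
      using D w wd contraction_rate_bounds by (simp add: \<epsilon>\<^sub>0_def)
    fix \<epsilon> :: real assume \<epsilon>: "0 < \<epsilon>" "\<epsilon> < \<epsilon>\<^sub>0"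
    \<comment> \<open>This keeps 1 - \<epsilon> s nonnegative for all secant slopes s \<le> 2
      |D|.\<close>
    have \<epsilon>1: "\<epsilon> * (2 * - D) < 1"
      using \<epsilon> D by (simp add: \<epsilon>\<^sub>0_def field_simps)
    have \<epsilon>2: "\<epsilon> * (1 + w * drift) < w * (1 - contraction_rate)"
      using \<epsilon> wd by (simp add: \<epsilon>\<^sub>0_def pos_less_divide_eq)
    show "stable_state p \<epsilon> (T_star p \<eta>\<^sub>0, \<eta>\<^sub>0)"
    proof (rule stable_if_ice_line_contracts[where w=w and \<rho>=\<rho> and a="\<epsilon> * (- D / 2)"
          and b=\<epsilon> and c="\<epsilon> * (2 * - D)" and d=\<epsilon>])
      show "w * (drift * (\<epsilon> * (2 * - D))) < \<epsilon> * (- D / 2)"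
        using mult_strict_left_mono[OF wK \<epsilon>(1)] by (simp add: mult_ac)
      show "\<epsilon> + w * (contraction_rate + drift * \<epsilon>) < w"
        using \<epsilon>2 by (simp add: algebra_simps)
      fix x :: state and u
      assume x: "x \<in> states" and u: "lag_bound x u" and e: "\<bar>snd x - \<eta>\<^sub>0\<bar> \<le> \<rho>" and "u \<le> \<rho>"
      define e where "e = snd x - \<eta>\<^sub>0"
      define v where "v = fst x (snd x) - T_star p (snd x) (snd x)"
      have range: "0 < snd x" "snd x < 1"
        using e \<rho> by linarith+
      obtain s where s: "- D / 2 \<le> s" "s \<le> 2 * - D" and "T_star p (snd x) (snd x) - pT\<^sub>c p = - (s * e)"
        using slope[of "snd x"] e \<rho> eq by (auto simp: e_def)
      then have inc: "fst x (snd x) - pT\<^sub>c p = v - s * e"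
        by (simp add: v_def)
      have v: "\<bar>v\<bar> \<le> u"
        using u range by (auto simp: lag_bound_def v_def)
      have \<epsilon>v: "\<bar>\<epsilon> * v\<bar> \<le> \<epsilon> * u"
        using v \<epsilon> by (simp add: abs_mult)
      have year: "snd (year p \<epsilon> x) = max 0 (min 1 (snd x + \<epsilon> * (v - s * e)))"
        using snd_year_interior[OF range] inc by simp
      have s1: "\<epsilon> * s \<le> 1"
        using mult_left_mono[OF s(2), of \<epsilon>] \<epsilon> \<epsilon>1 by linarith
      have "\<bar>snd (year p \<epsilon> x) - \<eta>\<^sub>0\<bar> \<le> \<bar>snd x + \<epsilon> * (v - s * e) - \<eta>\<^sub>0\<bar>"
        unfolding year using \<eta>\<^sub>0 by (intro clip_nonexpansive) auto
      also have "\<dots> = \<bar>(1 - \<epsilon> * s) * e + \<epsilon> * v\<bar>"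
        by (simp add: e_def algebra_simps)
      also have "\<dots> \<le> (1 - \<epsilon> * s) * \<bar>e\<bar> + \<epsilon> * u"
        using \<epsilon>v s1 abs_triangle_ineq[of "(1 - \<epsilon> * s) * e" "\<epsilon> * v"] by (simp add: abs_mult)
      also have "\<dots> \<le> (1 - \<epsilon> * (- D / 2)) * \<bar>e\<bar> + \<epsilon> * u"
        using s \<epsilon> by (intro add_right_mono mult_right_mono diff_left_mono mult_left_mono) auto
      finally have e': "\<bar>snd (year p \<epsilon> x) - \<eta>\<^sub>0\<bar> \<le> (1 - \<epsilon> * (- D / 2)) * \<bar>e\<bar> + \<epsilon> * u" .
      have "\<bar>snd (year p \<epsilon> x) - snd x\<bar> \<le> \<bar>snd x + \<epsilon> * (v - s * e) - snd x\<bar>"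
        unfolding year using range by (intro clip_nonexpansive) auto
      also have "\<dots> = \<bar>\<epsilon> * v - \<epsilon> * s * e\<bar>"
        by (simp add: algebra_simps)
      also have "\<dots> \<le> \<epsilon> * u + \<epsilon> * s * \<bar>e\<bar>"
      proof -
        have "\<bar>\<epsilon> * s * e\<bar> = \<epsilon> * s * \<bar>e\<bar>"
          using s D \<epsilon> by (simp add: abs_mult)
        then show ?thesis
          using \<epsilon>v abs_triangle_ineq4[of "\<epsilon> * v" "\<epsilon> * s * e"] by linarith
      qed
      also have "\<dots> \<le> \<epsilon> * u + \<epsilon> * (2 * - D) * \<bar>e\<bar>"
        using s \<epsilon> by (intro add_left_mono mult_right_mono mult_left_mono) auto
      finally show "\<bar>snd (year p \<epsilon> x) - \<eta>\<^sub>0\<bar> \<le> (1 - \<epsilon> * (- D / 2)) * \<bar>snd x - \<eta>\<^sub>0\<bar> + \<epsilon> * u \<and>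
          \<bar>snd (year p \<epsilon> x) - snd x\<bar> \<le> \<epsilon> * (2 * - D) * \<bar>snd x - \<eta>\<^sub>0\<bar> + \<epsilon> * u"
        using e' by (simp add: e_def)
    qed (use w \<rho> in auto)
  qed
qed

text \<open>Near the snowball the ice line loses at least a fixed amount a each year until it is
  stopped at 0. Since \<eta> < 1, this is at least a \<eta>, the linear form that the Lyapunov
  criterion asks for.\<close>

lemma lower_boundary_stable:
  assumes cold: "T_star p 0 0 < pT\<^sub>c p" and \<epsilon>: "0 < \<epsilon>"
  shows "stable_state p \<epsilon> (T_star p 0, 0)"
proof -
  \<comment> \<open>One third of the gap is spent on the lag and one on the variation of the
    diagonal; one remains.\<close>
  define \<gamma> where "\<gamma> = (pT\<^sub>c p - T_star p 0 0) / 3"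
  have \<gamma>: "0 < \<gamma>"
    using cold by (simp add: \<gamma>_def)
  have "isCont (\<lambda>\<eta>. T_star p \<eta> \<eta>) 0"
    by (rule DERIV_isCont[OF T_star_diagonal_deriv])
  then obtain \<rho>\<^sub>1 where \<rho>\<^sub>1: "0 < \<rho>\<^sub>1" "\<And>\<eta>. \<bar>\<eta>\<bar> < \<rho>\<^sub>1 \<Longrightarrow> \<bar>T_star p \<eta> \<eta> - T_star p 0 0\<bar> < \<gamma>"
    using \<gamma> unfolding continuous_at_eps_delta dist_real_def by (metis diff_zero)
  define \<rho> where "\<rho> = min (\<rho>\<^sub>1 / 2) (min (1 / 2) \<gamma>)"
  have \<rho>: "0 < \<rho>" "\<rho> < \<rho>\<^sub>1" "\<rho> < 1" "\<rho> \<le> \<gamma>"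
    using \<rho>\<^sub>1 \<gamma> by (auto simp: \<rho>_def min_less_iff_disj)
  define a where "a = min 1 (\<epsilon> * \<gamma>)"
  have a: "0 < a" "a \<le> 1" "a \<le> \<epsilon> * \<gamma>"
    using \<epsilon> \<gamma> by (auto simp: a_def)
  define w where "w = a / (drift + 1)"
  have w: "0 < w"
    using a drift_nonneg by (auto simp: w_def intro!: divide_pos_pos)
  have wK: "w * drift < a"
  proof -
    have "w * (drift + 1) = a"
      using drift_nonneg by (simp add: w_def)
    then show ?thesis
      using w unfolding distrib_left by linarith
  qed
  show ?thesis
  \<comment> \<open>c = 1 because a receding ice line that is stopped at 0 moves at most by its
    distance from 0.\<close>
  proof (rule stable_if_ice_line_contracts[where w=w and \<rho>=\<rho> and a=a and b=0 and c=1 and d=0])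
    show "0 + w * (contraction_rate + drift * 0) < w"
      using w contraction_rate_bounds by simp
    fix x :: state and u
    assume x: "x \<in> states" and u: "lag_bound x u" and e: "\<bar>snd x - 0\<bar> \<le> \<rho>" and u\<rho>: "u \<le> \<rho>"
    define i where "i = \<epsilon> * (fst x (snd x) - pT\<^sub>c p)"
    have range: "0 \<le> snd x" "snd x < 1"
      using x e \<rho> by (auto simp: states_def)
    have "\<bar>fst x (snd x) - T_star p (snd x) (snd x)\<bar> \<le> u"
      using u range by (auto simp: lag_bound_def)
    moreover have "\<bar>T_star p (snd x) (snd x) - T_star p 0 0\<bar> < \<gamma>"
      using \<rho>\<^sub>1(2)[of "snd x"] e \<rho> by auto
    moreover have "pT\<^sub>c p = T_star p 0 0 + 3 * \<gamma>"
      by (simp add: \<gamma>_def field_simps)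
    ultimately have "fst x (snd x) - pT\<^sub>c p \<le> - \<gamma>"
      using u\<rho> \<rho> by linarith
    then have i: "i \<le> - a"
      using mult_left_mono[of "fst x (snd x) - pT\<^sub>c p" "- \<gamma>" \<epsilon>] \<epsilon> a by (simp add: i_def)
    have year: "snd (year p \<epsilon> x) = (if snd x = 0 then 0 else max 0 (snd x + i))"
      using i a range by (auto simp: year_def ice_increment_def split_beta i_def)
    have "snd x + i \<le> (1 - a) * snd x"
      using i mult_left_mono[OF less_imp_le[OF range(2)] less_imp_le[OF a(1)]] by (simp add: left_diff_distrib)
    moreover have "0 \<le> (1 - a) * snd x"
      using a range by simp
    ultimately have "snd (year p \<epsilon> x) \<le> (1 - a) * snd x" "0 \<le> snd (year p \<epsilon> x)" "snd (year p \<epsilon> x) \<le> snd x"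
      using i a range unfolding year by auto
    then show "\<bar>snd (year p \<epsilon> x) - 0\<bar> \<le> (1 - a) * \<bar>snd x - 0\<bar> + 0 * u \<and>
        \<bar>snd (year p \<epsilon> x) - snd x\<bar> \<le> 1 * \<bar>snd x - 0\<bar> + 0 * u"
      using range by simp
  qed (use w \<rho> a wK in auto)
qed

section \<open>Unstable states\<close>

text \<open>In the cone u \<le> c e with e = \<eta> - \<open>\<eta>\<^sub>0\<close> > 0, the
  temperature at the ice line exceeds the critical one by at least (D / 2 - c) e, so e grows
  geometrically. The lag is forced only at order \<epsilon> and cannot leave the cone.\<close>

lemma interior_equilibrium_unstable:
  assumes \<eta>\<^sub>0: "0 < \<eta>\<^sub>0" "\<eta>\<^sub>0 < 1" and eq: "T_star p \<eta>\<^sub>0 \<eta>\<^sub>0 = pT\<^sub>c p"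
    and deriv: "((\<lambda>\<eta>. T_star p \<eta> \<eta>) has_real_derivative D) (at \<eta>\<^sub>0)" and D: "0 < D"
  obtains \<epsilon>\<^sub>0 where "0 < \<epsilon>\<^sub>0" "\<And>\<epsilon>. 0 < \<epsilon> \<Longrightarrow> \<epsilon> < \<epsilon>\<^sub>0 \<Longrightarrow> unstable_state p \<epsilon> (T_star p \<eta>\<^sub>0, \<eta>\<^sub>0)"
proof -
  obtain \<rho>\<^sub>1 where \<rho>\<^sub>1: "0 < \<rho>\<^sub>1"
    and slope: "\<And>\<eta>. \<bar>\<eta> - \<eta>\<^sub>0\<bar> < \<rho>\<^sub>1 \<Longrightarrow>
      \<exists>s. D / 2 \<le> s \<and> s \<le> 2 * D \<and> T_star p \<eta> \<eta> - T_star p \<eta>\<^sub>0 \<eta>\<^sub>0 = s * (\<eta> - \<eta>\<^sub>0)"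
    using DERIV_pos_two_sided_slope[OF deriv D] by auto
  define \<rho> where "\<rho> = min (\<rho>\<^sub>1 / 2) ((1 - \<eta>\<^sub>0) / 2)"
  have \<rho>: "0 < \<rho>" "\<rho> < \<rho>\<^sub>1" "\<rho> < 1 - \<eta>\<^sub>0"
    using \<rho>\<^sub>1 \<eta>\<^sub>0 by (auto simp: \<rho>_def min_less_iff_disj)
  \<comment> \<open>Half of the least secant slope D / 2: the lag uses up at most half of the
    growth.\<close>
  define c where "c = D / 4"
  have c: "0 < c"
    using D by (simp add: c_def)
  have den: "0 < drift * (2 * D + c) + 1"
    using D c drift_nonneg by (intro add_nonneg_pos mult_nonneg_nonneg) auto
  define \<epsilon>\<^sub>0 where "\<epsilon>\<^sub>0 = c * (1 - contraction_rate) / (drift * (2 * D + c) + 1)"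
  show thesis
  proof (rule that)
    show "0 < \<epsilon>\<^sub>0"
      using c den contraction_rate_bounds by (simp add: \<epsilon>\<^sub>0_def)
    fix \<epsilon> :: real assume \<epsilon>: "0 < \<epsilon>" "\<epsilon> < \<epsilon>\<^sub>0"
    have "\<epsilon> * (drift * (2 * D + c) + 1) < c * (1 - contraction_rate)"
      using \<epsilon> den by (simp add: \<epsilon>\<^sub>0_def pos_less_divide_eq)
    \<comment> \<open>Invariance of the cone: the contracted lag plus the shift of the equilibrium
      is at most c e, and e grows.\<close>
    then have \<epsilon>1: "contraction_rate * c + drift * (\<epsilon> * (2 * D + c)) \<le> c"
      using \<epsilon> by (simp add: algebra_simps)
    have grow: "(1 + \<epsilon> * c) * (snd x - \<eta>\<^sub>0) \<le> snd (year p \<epsilon> x) - \<eta>\<^sub>0 \<and>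
        lag_bound (year p \<epsilon> x) (c * (snd (year p \<epsilon> x) - \<eta>\<^sub>0))"
      if x: "x \<in> states" and e: "0 < snd x - \<eta>\<^sub>0" "snd x - \<eta>\<^sub>0 < \<rho>"
        and u: "lag_bound x (c * (snd x - \<eta>\<^sub>0))" and near: "snd (year p \<epsilon> x) - \<eta>\<^sub>0 < \<rho>" for x :: state
    proof -
      define e where "e = snd x - \<eta>\<^sub>0"
      define v where "v = fst x (snd x) - T_star p (snd x) (snd x)"
      have range: "0 < snd x" "snd x < 1"
        using e \<eta>\<^sub>0 \<rho> by linarith+
      have e0: "0 < e"
        using e by (simp add: e_def)
      obtain s where s: "D / 2 \<le> s" "s \<le> 2 * D" and "T_star p (snd x) (snd x) - pT\<^sub>c p = s * e"
        using slope[of "snd x"] e \<rho> eq by (auto simp: e_def)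
      then have inc: "fst x (snd x) - pT\<^sub>c p = v + s * e"
        by (simp add: v_def)
      have v: "\<bar>v\<bar> \<le> c * e"
        using u range by (auto simp: lag_bound_def v_def e_def)
      have "D / 2 * e \<le> s * e" "s * e \<le> 2 * D * e"
        using s e0 by (auto intro: mult_right_mono)
      then have inc_bounds: "c * e \<le> v + s * e" "v + s * e \<le> (2 * D + c) * e"
        using v by (auto simp: c_def distrib_right abs_le_iff)
      have \<epsilon>inc: "\<epsilon> * (c * e) \<le> \<epsilon> * (v + s * e)" "\<epsilon> * (v + s * e) \<le> \<epsilon> * ((2 * D + c) * e)"
        using inc_bounds \<epsilon> by (auto intro: mult_left_mono)
      have \<epsilon>ce: "0 \<le> \<epsilon> * (c * e)"
        using \<epsilon> c e0 by simp
      have "snd (year p \<epsilon> x) = max 0 (min 1 (snd x + \<epsilon> * (v + s * e)))"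
        using snd_year_interior[OF range] inc by simp
      \<comment> \<open>The upper stop is excluded by \<open>near\<close>: a stopped ice line would
        be at 1, farther than \<rho> from \<open>\<eta>\<^sub>0\<close>.\<close>
      then have year: "snd (year p \<epsilon> x) = snd x + \<epsilon> * (v + s * e)"
        using near \<rho> range \<epsilon>inc \<epsilon>ce by (auto simp: min_def max_def split: if_splits)
      have grows: "(1 + \<epsilon> * c) * e \<le> snd (year p \<epsilon> x) - \<eta>\<^sub>0"
        using \<epsilon>inc unfolding year by (simp add: e_def algebra_simps)
      have step: "\<bar>snd (year p \<epsilon> x) - snd x\<bar> \<le> \<epsilon> * ((2 * D + c) * e)"
        using \<epsilon>inc \<epsilon>ce unfolding year by simp
      have "contraction_rate * (c * e) + drift * \<bar>snd (year p \<epsilon> x) - snd x\<bar>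
          \<le> contraction_rate * (c * e) + drift * (\<epsilon> * ((2 * D + c) * e))"
        using step drift_nonneg by (intro add_left_mono mult_left_mono)
      also have "\<dots> = (contraction_rate * c + drift * (\<epsilon> * (2 * D + c))) * e"
        by (simp add: algebra_simps)
      also have "\<dots> \<le> c * e"
        using \<epsilon>1 e0 by (intro mult_right_mono) auto
      also have "\<dots> \<le> c * (snd (year p \<epsilon> x) - \<eta>\<^sub>0)"
        using \<epsilon>inc \<epsilon>ce c unfolding year by (intro mult_left_mono) (auto simp: e_def)
      finally have "lag_bound (year p \<epsilon> x) (c * (snd (year p \<epsilon> x) - \<eta>\<^sub>0))"
        using lag_bound_year[OF x u, of \<epsilon>] unfolding lag_bound_def e_def by fastforce
      then show ?thesis
        using grows by (simp add: e_def)
    qed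
    show "unstable_state p \<epsilon> (T_star p \<eta>\<^sub>0, \<eta>\<^sub>0)"
    proof
      let ?z = "(T_star p \<eta>\<^sub>0, \<eta>\<^sub>0)"
      assume "stable_state p \<epsilon> ?z"
      then obtain \<delta> where \<delta>: "0 < \<delta>"
        and stay: "\<And>x n. x \<in> states \<Longrightarrow> state_dist x ?z < \<delta> \<Longrightarrow> state_dist ((year p \<epsilon> ^^ n) x) ?z < \<rho>"
        using \<rho>(1) unfolding stable_state_def by blast
      define d where "d = min (\<rho> / 2) (\<delta> / (2 * (1 + drift)))"
      have d: "0 < d" "d < \<rho>"
        using \<rho> \<delta> drift_nonneg by (auto simp: d_def intro!: divide_pos_pos)
      have d\<delta>: "(1 + drift) * d < \<delta>"
      proof -
        have "(1 + drift) * d \<le> (1 + drift) * (\<delta> / (2 * (1 + drift)))"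
          using drift_nonneg by (intro mult_left_mono) (auto simp: d_def)
        also have "\<dots> < \<delta>"
          using \<delta> drift_nonneg by (simp add: field_simps add_pos_nonneg)
        finally show ?thesis .
      qed
      \<comment> \<open>The orbit starts with an equilibrium profile, so its lag is 0 and it lies in
        the cone.\<close>
      define x where "x n = (year p \<epsilon> ^^ n) (T_star p (\<eta>\<^sub>0 + d), \<eta>\<^sub>0 + d)" for n
      have x0: "x 0 \<in> states"
        using d \<rho> \<eta>\<^sub>0 by (auto simp: x_def states_def continuous_on_T_star)
      have states: "x n \<in> states" for n
        by (induction n) (use x0 year_in_states in \<open>auto simp: x_def\<close>)
      have "lag_bound (x 0) 0"
        by (simp add: lag_bound_def x_def)
      from state_dist_of_lag_bound[OF this, of \<eta>\<^sub>0] have "state_dist (x 0) ?z \<le> (1 + drift) * d"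
        using d by (simp add: x_def)
      then have "state_dist (x n) ?z < \<rho>" for n
        using stay[OF x0, of n] d\<delta> by (simp add: x_def)
      then have near: "snd (x n) - \<eta>\<^sub>0 < \<rho>" for n
        by (auto simp: state_dist_def abs_less_iff)
      have "(1 + \<epsilon> * c) ^ n * d \<le> snd (x n) - \<eta>\<^sub>0 \<and> lag_bound (x n) (c * (snd (x n) - \<eta>\<^sub>0))" for n
      proof (induction n)
        case 0
        show ?case
          using c d by (simp add: x_def lag_bound_def)
      next
        case (Suc n)
        have pos: "0 < 1 + \<epsilon> * c"
          using \<epsilon> c by (simp add: add_pos_pos)
        then have "0 < (1 + \<epsilon> * c) ^ n * d"
          using d by simp
        then have *: "(1 + \<epsilon> * c) * (snd (x n) - \<eta>\<^sub>0) \<le> snd (x (Suc n)) - \<eta>\<^sub>0"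
            "lag_bound (x (Suc n)) (c * (snd (x (Suc n)) - \<eta>\<^sub>0))"
          using grow[OF states _ near, of n] Suc near[of "Suc n"] by (auto simp: x_def)
        have "(1 + \<epsilon> * c) * ((1 + \<epsilon> * c) ^ n * d) \<le> (1 + \<epsilon> * c) * (snd (x n) - \<eta>\<^sub>0)"
          using Suc pos by (intro mult_left_mono) auto
        then show ?case
          using * by (simp add: mult.assoc)
      qed
      moreover obtain n where "\<rho> / d < (1 + \<epsilon> * c) ^ n"
        using real_arch_pow[of "1 + \<epsilon> * c" "\<rho> / d"] \<epsilon> c by auto
      then have "\<rho> < (1 + \<epsilon> * c) ^ n * d"
        using d by (simp add: pos_divide_less_eq)
      ultimately show False
        using near[of n] by (meson less_trans not_less)
    qed
  qed
qed

end

text \<open>The state is not a fixed point: started exactly there, the ice line recedes in the first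
  year, and this displacement is a radius that refutes stability.\<close>

lemma upper_boundary_unstable:
  assumes cold: "T_star p 1 1 < pT\<^sub>c p" and \<epsilon>: "0 < \<epsilon>"
  shows "unstable_state p \<epsilon> (T_star p 1, 1)"
proof
  let ?z = "(T_star p 1, 1)"
  let ?d = "1 - snd (year p \<epsilon> ?z)"
  have "\<epsilon> * (T_star p 1 1 - pT\<^sub>c p) < 0"
    using cold \<epsilon> by (intro mult_pos_neg) auto
  then have d: "0 < ?d"
    by (auto simp: year_def ice_increment_def)
  assume "stable_state p \<epsilon> ?z"
  with d obtain \<delta> where "0 < \<delta>"
    and stay: "\<And>x n. x \<in> states \<Longrightarrow> state_dist x ?z < \<delta> \<Longrightarrow> state_dist ((year p \<epsilon> ^^ n) x) ?z < ?d"
    unfolding stable_state_def by blast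
  have "?z \<in> states"
    by (auto simp: states_def continuous_on_T_star)
  moreover have "state_dist ?z ?z < \<delta>"
    using \<open>0 < \<delta>\<close> by (simp add: state_dist_def sup_norm_def)
  ultimately have "state_dist ((year p \<epsilon> ^^ 1) ?z) ?z < ?d"
    by (rule stay)
  then show False
    by (auto simp: state_dist_def)
qed

section \<open>The equilibria for the given parameters\<close>

definition earth :: ice_line_params where
  "earth = \<lparr>pQ = 343, p\<alpha>\<^sub>1 = 0.32, p\<alpha>\<^sub>2 = 0.62, pA = 202, pB = 1.9, pC = 3.04,
            pT\<^sub>c = -10, pR = 12.6, pM = 25\<rparr>"

lemma earth_diagonal:
  "T_star earth \<eta> \<eta> = (18179 / 100 * insolation \<eta> - 8232 / 100 * tanh_moment 25 \<eta> - 234336 / 1000) / (494 / 100)"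
  by (simp add: T_star_diagonal mean_absorbed_eq earth_def field_simps)

lemma earth_diagonal_slope:
  "diagonal_slope earth \<eta> = 343 * (24 / 100 * tanh_moment_slope 25 \<eta> - 76638 / 100000 * \<eta>) / (494 / 100)"
  by (simp add: diagonal_slope_def earth_def field_simps)

text \<open>
  In terms of \<open>s = insolation \<eta>\<close> and \<open>I = tanh_moment 25 \<eta>\<close>, the inequality \<open>T_star earth \<eta> \<eta> > -10\<close>
  reads \<open>181.79 s - 82.32 I > 184.936\<close>.  The criteria below insert the bounds on \<open>I\<close>, with
  \<open>exp (- x) \<le> 1 / (1 + x)\<close> in the first and \<open>267.256 = 184.936 + 82.32\<close>.
\<close>

lemma earth_diagonal_warm:
  assumes "\<eta> \<in> {0..1}"
    and "18179 / 100 * (1241 / 1000 - 723 / 1000 * \<eta>\<^sup>2) + 16464 / 100 * (1241 / 1000 * \<eta> - 241 / 1000 * \<eta> ^ 3)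
      - 8232 / 100 * (518 / 25000 / (1 + 50 * (1 - \<eta>)) + 1446 / 625000) > 267256 / 1000"
  shows "T_star earth \<eta> \<eta> > -10"
proof -
  have "exp (- x) \<le> 1 / (1 + x)" if "0 \<le> x" for x :: real
    using exp_ge_add_one_self[of x] that by (simp add: exp_minus field_simps)
  from this[of "50 * (1 - \<eta>)"] have "exp (- (50 * (1 - \<eta>))) \<le> 1 / (1 + 50 * (1 - \<eta>))"
    using assms(1) by simp
  then have "518 / 25000 * exp (- (50 * (1 - \<eta>))) \<le> 518 / 25000 * (1 / (1 + 50 * (1 - \<eta>)))"
    by (rule mult_left_mono) simp
  then have "tanh_moment 25 \<eta> \<le> 1 - 2 * (1241 / 1000 * \<eta> - 241 / 1000 * \<eta> ^ 3)
      + 518 / 25000 / (1 + 50 * (1 - \<eta>)) + 1446 / 625000"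
    using tanh_moment_upper[of 25 \<eta>] assms(1) by simp
  then have "18179 / 100 * insolation \<eta> - 8232 / 100 * tanh_moment 25 \<eta> > 184936 / 1000"
    using assms(2) unfolding insolation_eq by (simp only: right_diff_distrib distrib_left)
  then show ?thesis
    unfolding earth_diagonal by simp
qed

lemma earth_diagonal_cold:
  assumes "\<eta> \<in> {0..1}"
    and "18179 / 100 * (1241 / 1000 - 723 / 1000 * \<eta>\<^sup>2) + 16464 / 100 * (1241 / 1000 * \<eta> - 241 / 1000 * \<eta> ^ 3)
      + 8232 / 100 * (1241 / 25000) < 267256 / 1000"
  shows "T_star earth \<eta> \<eta> < -10"
proof -
  have "18179 / 100 * insolation \<eta> - 8232 / 100 * tanh_moment 25 \<eta> < 184936 / 1000"
    using tanh_moment_lower[OF _ assms(1), of 25] assms(2) unfolding insolation_eq by linarith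
  then show ?thesis
    unfolding earth_diagonal by simp
qed

section \<open>Shape and roots of the diagonal\<close>

text \<open>From e \<ge> 2 follows e^5 \<ge> 32, hence tanh (5 / 2) \<ge> (1 - 1 / 32) / (1 + 1 /
  32). The threshold is 25 \<eta> at \<eta> = 1 / 10, where the next proof splits.\<close>

lemma tanh_ge_31_33:
  fixes x :: real
  assumes "5 / 2 \<le> x"
  shows "31 / 33 \<le> tanh x"
proof -
  have "(2::real) ^ 5 \<le> exp 1 ^ 5"
    using exp_ge_add_one_self[of "1::real"] by (intro power_mono) auto
  then have "32 \<le> exp (5::real)"
    by (simp flip: exp_of_nat_mult)
  then have "exp (- 5) \<le> (1 / 32 :: real)"
    by (simp add: exp_minus inverse_eq_divide le_imp_inverse_le field_simps)
  then have "31 / 33 \<le> (1 - exp (- 5)) / (1 + exp (- 5) :: real)"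
    by (subst pos_le_divide_eq) (auto simp: add_pos_pos)
  also have "\<dots> = tanh (5 / 2)"
    by (simp add: tanh_real_altdef)
  also have "\<dots> \<le> tanh x"
    using assms by simp
  finally show ?thesis .
qed

text \<open>The sign is that of \<open>tanh_moment_slope 25 \<eta>\<close> - 3.19325 \<eta>, where
  3.19325 = 0.76638 / 0.24. Up to \<eta> = 1 / 10 the boundary term at y = 1 suffices; beyond, both
  tanh terms are close to 1.\<close>

lemma earth_diagonal_slope_pos:
  assumes "\<eta> \<in> {0..45 / 100}"
  shows "0 < diagonal_slope earth \<eta>"
proof -
  have lower: "518 / 1000 * (31 / 33) + 1241 / 1000 * tanh (25 * \<eta>) - 723 / 1000 * \<eta>\<^sup>2 \<le> tanh_moment_slope 25 \<eta>"
    using tanh_moment_slope_bounds(2)[of 25 \<eta>] tanh_ge_31_33[of "25 * (1 - \<eta>)"] assms by auto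
  have "319325 / 100000 * \<eta> < tanh_moment_slope 25 \<eta>"
  proof (cases "\<eta> \<le> 1 / 10")
    case True
    have "0 \<le> tanh (25 * \<eta>)"
      using assms by simp
    moreover have "\<eta>\<^sup>2 \<le> 1 / 100"
      using power_mono[of \<eta> "1 / 10" 2] assms True by (simp add: power2_eq_square)
    ultimately show ?thesis
      using lower True by linarith
  next
    case False
    have "31 / 33 \<le> tanh (25 * \<eta>)"
      using False by (intro tanh_ge_31_33) auto
    moreover have "\<eta>\<^sup>2 \<le> 2025 / 10000"
      using power_mono[of \<eta> "45 / 100" 2] assms by (simp add: power2_eq_square)
    ultimately show ?thesis
      using lower assms unfolding atLeastAtMost_iff by linarith
  qed
  then show ?thesis
    unfolding earth_diagonal_slope by simp
qed

text \<open>The upper bound on \<open>tanh_moment_slope\<close> decreases in \<eta> while 3.193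
  \<eta> increases, so \<eta> = 7 / 10 is the worst case; 3.193 is 3.19325 rounded down.\<close>

lemma earth_diagonal_slope_neg:
  assumes "\<eta> \<in> {7 / 10..1}"
  shows "diagonal_slope earth \<eta> < 0"
proof -
  have "(7 / 10)\<^sup>2 \<le> \<eta>\<^sup>2"
    using assms by (intro power_mono) auto
  then have "tanh_moment_slope 25 \<eta> < 3193 / 1000 * \<eta>"
    using tanh_moment_slope_bounds(1)[of 25 \<eta>] assms by (simp add: power2_eq_square)
  then show ?thesis
    unfolding earth_diagonal_slope using assms by simp
qed

text \<open>This excludes roots in the gap between the two ranges of monotonicity.\<close>

lemma earth_diagonal_warm_middle:
  assumes "\<eta> \<in> {45 / 100..7 / 10}"
  shows "T_star earth \<eta> \<eta> > -10"
proof (rule earth_diagonal_warm)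
  \<comment> \<open>The cubic is bounded by a quadratic and the quadratic by its chord over the
    interval, which leaves a linear inequality in \<eta>.\<close>
  have "\<eta> ^ 3 \<le> 7 / 10 * \<eta>\<^sup>2"
    using assms by (simp add: power3_eq_cube power2_eq_square mult_right_mono)
  moreover have "0 \<le> (\<eta> - 45 / 100) * (7 / 10 - \<eta>)"
    using assms by simp
  moreover have "(\<eta> - 45 / 100) * (7 / 10 - \<eta>) = 115 / 100 * \<eta> - 315 / 1000 - \<eta>\<^sup>2"
    by (simp add: field_simps power2_eq_square)
  moreover have "518 / 25000 / (1 + 50 * (1 - \<eta>)) \<le> 518 / 25000"
    using assms by (simp add: divide_le_eq)
  ultimately show "18179 / 100 * (1241 / 1000 - 723 / 1000 * \<eta>\<^sup>2) + 16464 / 100 * (1241 / 1000 * \<eta> - 241 / 1000 * \<eta> ^ 3)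
      - 8232 / 100 * (518 / 25000 / (1 + 50 * (1 - \<eta>)) + 1446 / 625000) > 267256 / 1000"
    using assms unfolding atLeastAtMost_iff by (simp only: right_diff_distrib distrib_left) linarith
qed (use assms in auto)

text \<open>The diagonal increases up to 0.45, stays above -10 up to 0.7 and decreases from there
  on. Sign changes give one root in each monotone range, and monotonicity carries the cold values at
  0.15 and 0.982 to the endpoints 0 and 1.\<close>

lemma earth_equilibria:
  obtains \<eta>\<^sub>1 \<eta>\<^sub>2 where
    "{\<eta> \<in> {0..1}. T_star earth \<eta> \<eta> = -10} = {\<eta>\<^sub>1, \<eta>\<^sub>2}"
    "\<eta>\<^sub>1 \<in> {15 / 100<..<25 / 100}" "\<eta>\<^sub>2 \<in> {942 / 1000<..<982 / 1000}"
    "T_star earth 0 0 < -10" "T_star earth 1 1 < -10"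
proof -
  let ?h = "\<lambda>\<eta>. T_star earth \<eta> \<eta>"
  have incr: "?h a < ?h b" if "0 \<le> a" "a < b" "b \<le> 45 / 100" for a b
  proof (rule DERIV_pos_imp_increasing[OF that(2)])
    show "\<exists>y. (?h has_real_derivative y) (at x) \<and> 0 < y" if "a \<le> x" "x \<le> b" for x
      using T_star_diagonal_deriv[of earth x] earth_diagonal_slope_pos[of x] that \<open>0 \<le> a\<close> \<open>b \<le> 45 / 100\<close>
      by auto
  qed
  have decr: "?h b < ?h a" if "7 / 10 \<le> a" "a < b" "b \<le> 1" for a b
  proof (rule DERIV_neg_imp_decreasing[OF that(2)])
    show "\<exists>y. (?h has_real_derivative y) (at x) \<and> y < 0" if "a \<le> x" "x \<le> b" for x
      using T_star_diagonal_deriv[of earth x] earth_diagonal_slope_neg[of x] that \<open>7 / 10 \<le> a\<close> \<open>b \<le> 1\<close>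
      by auto
  qed
  have cont: "isCont ?h \<eta>" for \<eta>
    by (rule DERIV_isCont[OF T_star_diagonal_deriv])
  have h15: "?h (15 / 100) < -10" and h982: "?h (982 / 1000) < -10"
    by (rule earth_diagonal_cold; simp add: power2_eq_square power3_eq_cube)+
  have h25: "-10 < ?h (25 / 100)" and h942: "-10 < ?h (942 / 1000)"
    by (rule earth_diagonal_warm; simp add: power2_eq_square power3_eq_cube)+
  obtain \<eta>\<^sub>1 where \<eta>\<^sub>1: "15 / 100 \<le> \<eta>\<^sub>1" "\<eta>\<^sub>1 \<le> 25 / 100" "?h \<eta>\<^sub>1 = -10"
    using IVT[of ?h "15 / 100" "-10" "25 / 100"] h15 h25 cont by auto
  obtain \<eta>\<^sub>2 where \<eta>\<^sub>2: "942 / 1000 \<le> \<eta>\<^sub>2" "\<eta>\<^sub>2 \<le> 982 / 1000" "?h \<eta>\<^sub>2 = -10"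
    using IVT2[of ?h "982 / 1000" "-10" "942 / 1000"] h942 h982 cont by auto
  have uniq: "\<eta> = \<eta>\<^sub>1 \<or> \<eta> = \<eta>\<^sub>2" if "\<eta> \<in> {0..1}" "?h \<eta> = -10" for \<eta>
  proof -
    consider "\<eta> \<le> 45 / 100" | "\<eta> \<in> {45 / 100..7 / 10}" | "7 / 10 \<le> \<eta>"
      by fastforce
    then show ?thesis
    proof cases
      case 1
      then show ?thesis
        using incr[of \<eta> \<eta>\<^sub>1] incr[of \<eta>\<^sub>1 \<eta>] \<eta>\<^sub>1 that by force
    next
      case 2
      then show ?thesis
        using earth_diagonal_warm_middle that by force
    next
      case 3
      then show ?thesis
        using decr[of \<eta> \<eta>\<^sub>2] decr[of \<eta>\<^sub>2 \<eta>] \<eta>\<^sub>2 that by force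
    qed
  qed
  show thesis
  proof (rule that)
    show "{\<eta> \<in> {0..1}. ?h \<eta> = -10} = {\<eta>\<^sub>1, \<eta>\<^sub>2}"
      using uniq \<eta>\<^sub>1 \<eta>\<^sub>2 by auto
    \<comment> \<open>The test points are not roots, so the enclosures are strict.\<close>
    have "\<eta>\<^sub>1 \<noteq> 15 / 100" "\<eta>\<^sub>1 \<noteq> 25 / 100" "\<eta>\<^sub>2 \<noteq> 942 / 1000" "\<eta>\<^sub>2 \<noteq> 982 / 1000"
      using \<eta>\<^sub>1(3) \<eta>\<^sub>2(3) h15 h25 h942 h982 by (metis less_irrefl)+
    then show "\<eta>\<^sub>1 \<in> {15 / 100<..<25 / 100}" "\<eta>\<^sub>2 \<in> {942 / 1000<..<982 / 1000}"
      using \<eta>\<^sub>1 \<eta>\<^sub>2 unfolding greaterThanLessThan_iff by linarith+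
    show "?h 0 < -10"
      using incr[of 0 "15 / 100"] h15 by simp
    show "?h 1 < -10"
      using decr[of "982 / 1000" 1] h982 by simp
  qed
qed

theorem corollary3p5:
  fixes p :: ice_line_params
  assumes "p = \<lparr>pQ = 343, p\<alpha>\<^sub>1 = 0.32, p\<alpha>\<^sub>2 = 0.62, pA = 202, pB = 1.9, pC = 3.04,
                pT\<^sub>c = -10, pR = 12.6, pM = 25\<rparr>"
  shows "\<exists>\<eta>\<^sub>1 \<eta>\<^sub>2. \<eta>\<^sub>1 < \<eta>\<^sub>2 \<and>
           {\<eta> \<in> {0..1}. T_star p \<eta> \<eta> = pT\<^sub>c p} = {\<eta>\<^sub>1, \<eta>\<^sub>2} \<and>
           \<bar>\<eta>\<^sub>1 - 0.2\<bar> < 0.05 \<and> \<bar>\<eta>\<^sub>2 - 0.962\<bar> < 0.02 \<and>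
           (\<exists>\<epsilon>\<^sub>0>0. \<forall>\<epsilon>. 0 < \<epsilon> \<and> \<epsilon> < \<epsilon>\<^sub>0 \<longrightarrow>
              unstable_state p \<epsilon> (T_star p 1, 1) \<and>
              unstable_state p \<epsilon> (T_star p \<eta>\<^sub>1, \<eta>\<^sub>1) \<and>
              stable_state p \<epsilon> (T_star p \<eta>\<^sub>2, \<eta>\<^sub>2) \<and>
              stable_state p \<epsilon> (T_star p 0, 0))"
proof -
  have p: "p = earth" and T\<^sub>c: "pT\<^sub>c p = -10"
    using assms by (simp_all add: earth_def)
  interpret dissipative_ice_line p
    by unfold_locales (simp_all add: assms)
  obtain \<eta>\<^sub>1 \<eta>\<^sub>2 where roots: "{\<eta> \<in> {0..1}. T_star p \<eta> \<eta> = pT\<^sub>c p} = {\<eta>\<^sub>1, \<eta>\<^sub>2}"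
    and \<eta>\<^sub>1: "\<eta>\<^sub>1 \<in> {15 / 100<..<25 / 100}" and \<eta>\<^sub>2: "\<eta>\<^sub>2 \<in> {942 / 1000<..<982 / 1000}"
    and cold: "T_star p 0 0 < pT\<^sub>c p" "T_star p 1 1 < pT\<^sub>c p"
    by (rule earth_equilibria[folded p, folded T\<^sub>c])
  have eq: "T_star p \<eta>\<^sub>1 \<eta>\<^sub>1 = pT\<^sub>c p" "T_star p \<eta>\<^sub>2 \<eta>\<^sub>2 = pT\<^sub>c p"
    using roots by blast+
  have "0 < diagonal_slope p \<eta>\<^sub>1"
    unfolding p by (rule earth_diagonal_slope_pos) (use \<eta>\<^sub>1 in auto)
  with \<eta>\<^sub>1 obtain e\<^sub>1 where e\<^sub>1: "0 < e\<^sub>1"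
    "\<And>\<epsilon>. 0 < \<epsilon> \<Longrightarrow> \<epsilon> < e\<^sub>1 \<Longrightarrow> unstable_state p \<epsilon> (T_star p \<eta>\<^sub>1, \<eta>\<^sub>1)"
    using interior_equilibrium_unstable[OF _ _ eq(1) T_star_diagonal_deriv] by auto
  have "diagonal_slope p \<eta>\<^sub>2 < 0"
    unfolding p by (rule earth_diagonal_slope_neg) (use \<eta>\<^sub>2 in auto)
  with \<eta>\<^sub>2 obtain e\<^sub>2 where e\<^sub>2: "0 < e\<^sub>2"
    "\<And>\<epsilon>. 0 < \<epsilon> \<Longrightarrow> \<epsilon> < e\<^sub>2 \<Longrightarrow> stable_state p \<epsilon> (T_star p \<eta>\<^sub>2, \<eta>\<^sub>2)"
    using interior_equilibrium_stable[OF _ _ eq(2) T_star_diagonal_deriv] by auto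
  \<comment> \<open>Only the two interior states bound \<epsilon> from above.\<close>
  have "\<exists>\<epsilon>\<^sub>0>0. \<forall>\<epsilon>. 0 < \<epsilon> \<and> \<epsilon> < \<epsilon>\<^sub>0 \<longrightarrow>
      unstable_state p \<epsilon> (T_star p 1, 1) \<and> unstable_state p \<epsilon> (T_star p \<eta>\<^sub>1, \<eta>\<^sub>1) \<and>
      stable_state p \<epsilon> (T_star p \<eta>\<^sub>2, \<eta>\<^sub>2) \<and> stable_state p \<epsilon> (T_star p 0, 0)"
    using e\<^sub>1 e\<^sub>2 upper_boundary_unstable[OF cold(2)] lower_boundary_stable[OF cold(1)]
    by (intro exI[of _ "min e\<^sub>1 e\<^sub>2"]) auto
  moreover have "\<bar>\<eta>\<^sub>1 - 0.2\<bar> < 0.05" "\<bar>\<eta>\<^sub>2 - 0.962\<bar> < 0.02"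
    using \<eta>\<^sub>1 \<eta>\<^sub>2 unfolding abs_less_iff by auto
  moreover have "\<eta>\<^sub>1 < \<eta>\<^sub>2"
    using \<eta>\<^sub>1 \<eta>\<^sub>2 by auto
  ultimately show ?thesis
    using roots by blast
qed

end
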